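(* Let $G$ be any graph, and let $G'$ be a subdivision of $G$ in which every edge of $G$ is subdivided with at least one vertex. Then there exists a convex-polyhedral surface $\mathcal{S}$ in $\mathbb{R}^3$ whose adjacency graph $\mathcal{G}(\mathcal{S})$ is isomorphic to $G'$.
   Context: Graphs are finite, simple and undirected. A polygon in $\mathbb{R}^3$ is a closed planar region (including its interior) bounded by a simple closed polygonal chain lying in some plane of $\mathbb{R}^3$; its vertices are called corners and its edges are called sides. A polyhedral surface $\mathcal{S}=\{S_1,\dots,S_n\}$ is a set of $n$ closed polygons embedded in $\mathbb{R}^3$ such that, for all pairwise distinct indices $i,j,k$: (1) $S_i$ and $S_j$ are interior-disjoint (with respect to the 2D relative interiors); (2) if $S_i\cap S_j\neq\emptyset$, then $S_i\cap S_j$ is either a single corner or a complete side of both $S_i$ and $S_j$; (3) if $S_i\cap S_j\cap S_k\neq\emptyset$, then it is a single corner (so a side is shared by at most two polygons). Sides need not be shared with another polygon. The adjacency graph $\mathcal{G}(\mathcal{S})$ has one vertex for each polygon of $\mathcal{S}$ and an edge between two vertices if and only if the corresponding polygons share a side (contacts in a single corner do not give an edge). A convex-polyhedral surface is a polyhedral surface all of whose polygons are strictly convex. *)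

theory Defs
  imports
    "HOL-Analysis.Analysis"
    "Graph_Theory.Subdivision"
    "Graph_Theory.Digraph_Isomorphism"
begin

section \<open>Polygons in three-space\<close>

text \<open>A polygon is given by the cyclic list of its corners. The lists that arise from one another
  by rotation or reversal describe the same polygon.\<close>

definition next_corner :: "(real^3) list \<Rightarrow> nat \<Rightarrow> real^3" where
  "next_corner P i = P ! (Suc i mod length P)"

definition side :: "(real^3) list \<Rightarrow> nat \<Rightarrow> (real^3) set" where
  "side P i = closed_segment (P ! i) (next_corner P i)"

definition sides :: "(real^3) list \<Rightarrow> (real^3) set set" where
  "sides P = side P ` {..<length P}"

definition simple_closed_chain :: "(real^3) list \<Rightarrow> bool" where
  "simple_closed_chain P \<longleftrightarrow>
     3 \<le> length P \<and> distinct P \<and>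
     (\<forall>i<length P. \<forall>j<length P. i \<noteq> j \<longrightarrow>
        side P i \<inter> side P j = {P ! i, next_corner P i} \<inter> {P ! j, next_corner P j})"

definition polygon :: "(real^3) list \<Rightarrow> bool" where
  "polygon P \<longleftrightarrow> simple_closed_chain P \<and> coplanar (set P)"

text \<open>The closed region bounded by the chain. Its interior consists of the points of the plane of
  the chain that lie in a bounded component of the complement of the chain in that plane; the
  constant \<^const>\<open>inside\<close> refers to the complement in the whole space, where it is empty.\<close>

definition region :: "(real^3) list \<Rightarrow> (real^3) set" where
  "region P =
     \<Union>(sides P) \<union>
     {x \<in> affine hull set P - \<Union>(sides P).
        bounded (connected_component_set (affine hull set P - \<Union>(sides P)) x)}"

text \<open>Strict convexity: the region is convex and no interior angle equals \<open>\<pi>\<close>.\<close>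

definition strictly_convex_polygon :: "(real^3) list \<Rightarrow> bool" where
  "strictly_convex_polygon P \<longleftrightarrow>
     polygon P \<and> convex (region P) \<and>
     (\<forall>i<length P. \<not> collinear {P ! i, next_corner P i, next_corner P (Suc i)})"


section \<open>Polyhedral surfaces\<close>

text \<open>The region of a polygon has nonempty relative interior, so the first condition also rules out
  that a surface contains two corner lists of the same polygon.\<close>

definition polyhedral_surface :: "(real^3) list set \<Rightarrow> bool" where
  "polyhedral_surface S \<longleftrightarrow>
     finite S \<and> (\<forall>P\<in>S. polygon P) \<and>
     (\<forall>P\<in>S. \<forall>Q\<in>S. P \<noteq> Q \<longrightarrow>
        rel_interior (region P) \<inter> rel_interior (region Q) = {}) \<and>
     (\<forall>P\<in>S. \<forall>Q\<in>S. P \<noteq> Q \<longrightarrow> region P \<inter> region Q \<noteq> {} \<longrightarrow>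
        (\<exists>c \<in> set P \<inter> set Q. region P \<inter> region Q = {c}) \<or>
        region P \<inter> region Q \<in> sides P \<inter> sides Q) \<and>
     (\<forall>P\<in>S. \<forall>Q\<in>S. \<forall>R\<in>S. P \<noteq> Q \<longrightarrow> Q \<noteq> R \<longrightarrow> P \<noteq> R \<longrightarrow>
        region P \<inter> region Q \<inter> region R \<noteq> {} \<longrightarrow>
        (\<exists>c \<in> set P \<inter> set Q \<inter> set R. region P \<inter> region Q \<inter> region R = {c}))"

definition convex_polyhedral_surface :: "(real^3) list set \<Rightarrow> bool" where
  "convex_polyhedral_surface S \<longleftrightarrow>
     polyhedral_surface S \<and> (\<forall>P\<in>S. strictly_convex_polygon P)"

text \<open>As usual for \<^locale>\<open>pair_graph\<close>, an undirected edge is represented by both of its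
  orientations.\<close>

definition adjacency_graph :: "(real^3) list set \<Rightarrow> (real^3) list pair_pre_digraph" where
  "adjacency_graph S =
     \<lparr> pverts = S,
       parcs = {(P, Q). P \<in> S \<and> Q \<in> S \<and> P \<noteq> Q \<and> sides P \<inter> sides Q \<noteq> {}} \<rparr>"


section \<open>Subdivisions\<close>

text \<open>Subdividing an edge deletes it, and every edge introduced by a subdivision step has a new
  vertex as an end. Hence an edge of \<open>G\<close> is subdivided at least once if and only if it is not an
  edge of the resulting graph.\<close>

definition every_edge_subdivided :: "'a pair_pre_digraph \<Rightarrow> 'a pair_pre_digraph \<Rightarrow> bool" where
  "every_edge_subdivided G G' \<longleftrightarrow> subdivision_pair G G' \<and> parcs G \<inter> parcs G' = {}"

end

theory Submission
  imports Defs
begin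

text \<open>
  Each vertex \<open>v\<close> of \<open>G\<close> becomes a polygon in its own horizontal plane with corners on the parabola
  \<open>y = x\<^sup>2\<close>, so that all corners of all these polygons are in convex position when seen from above.
  Every edge \<open>e\<close> of \<open>G\<close> owns two consecutive parameters \<open>a\<close>, \<open>a + 1\<close> on the parabola, which only the two
  ends of \<open>e\<close> use as corners. The vertical wall above this chord supports every polygon, and it meets
  exactly the polygons of the ends of \<open>e\<close>, each in a complete side. The vertices that subdivide \<open>e\<close>
  become rectangles that are stacked in this wall between the heights of the ends of \<open>e\<close>.
\<close>

section \<open>Stacking a subdivision\<close>

text \<open>Once the walls are fixed, a one-dimensional problem remains: every edge of
  \<open>G\<close> has a column of intervals of heights, and their positions decide all contacts.
  The locale \<open>layout\<close> records only this, so the induction over subdivision steps is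
  free of geometry. Since heights are real, a new interval fits anywhere in a stack, and at most one
  old interval changes in a step, by shrinking. The vertices of \<open>G\<close> receive pairwise
  distinct heights, so their polygons never meet each other. Adjacent vertices of \<open>G\<close>
  therefore cannot be drawn directly, which is why every edge has to be subdivided. Natural
  parameters make the walls work: no natural number lies strictly between \<open>a\<close> and
  \<open>a + 1\<close>, so the wall through these two supports all corners of all polygons at once.
  A polygon then meets a wall exactly in the hull of its corners there. The topological obstacle is
  that \<open>region\<close> is defined by bounded components of the complement of the chain in its
  plane. It is identified with the convex hull of the corners once, for every chain whose sides have
  suitable supporting planes.\<close>

definition edge_set :: "'a pair_pre_digraph \<Rightarrow> 'a set set" where
  "edge_set G = {{u, v} | u v. (u, v) \<in> parcs G}"

definition in_column :: "'a pair_pre_digraph \<Rightarrow> ('a \<Rightarrow> 'a set) \<Rightarrow> 'a \<Rightarrow> 'a set \<Rightarrow> bool" where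
  "in_column G cl x e \<longleftrightarrow> e \<in> edge_set G \<and> (if x \<in> pverts G then x \<in> e else cl x = e)"

text \<open>The interval \<open>{lo x..hi x}\<close> is the range of heights of the polygon of \<open>x\<close>, which is a single point
  for a vertex of \<open>G\<close>, and \<open>cl\<close> assigns to a subdividing vertex the edge that it subdivides. The values of
  \<open>cl\<close> on \<open>pverts G\<close> are irrelevant. The last condition keeps track of the edges of \<open>G\<close> that
  are not subdivided yet.\<close>

locale layout =
  fixes G :: "'a pair_pre_digraph" and z :: "'a \<Rightarrow> real" and H :: "'a pair_pre_digraph"
    and lo hi :: "'a \<Rightarrow> real" and cl :: "'a \<Rightarrow> 'a set"
  assumes verts_subset: "pverts G \<subseteq> pverts H"
    and original: "x \<in> pverts G \<Longrightarrow> lo x = z x \<and> hi x = z x"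
    and subdividing: "x \<in> pverts H \<Longrightarrow> x \<notin> pverts G \<Longrightarrow> lo x < hi x \<and> cl x \<in> edge_set G"
    and ordered: "x \<in> pverts H \<Longrightarrow> y \<in> pverts H \<Longrightarrow> x \<noteq> y \<Longrightarrow>
      in_column G cl x e \<Longrightarrow> in_column G cl y e \<Longrightarrow> hi x \<le> lo y \<or> hi y \<le> lo x"
    and no_triple: "x \<in> pverts H \<Longrightarrow> y \<in> pverts H \<Longrightarrow> x' \<in> pverts H \<Longrightarrow>
      x \<noteq> y \<Longrightarrow> y \<noteq> x' \<Longrightarrow> x \<noteq> x' \<Longrightarrow>
      in_column G cl x e \<Longrightarrow> in_column G cl y e \<Longrightarrow> in_column G cl x' e \<Longrightarrow>
      h \<in> {lo x..hi x} \<Longrightarrow> h \<in> {lo y..hi y} \<Longrightarrow> h \<notin> {lo x'..hi x'}"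
    and arcs_iff: "x \<in> pverts H \<Longrightarrow> y \<in> pverts H \<Longrightarrow> x \<notin> pverts G \<or> y \<notin> pverts G \<Longrightarrow>
      (x, y) \<in> parcs H \<longleftrightarrow> x \<noteq> y \<and> (\<exists>e. in_column G cl x e \<and> in_column G cl y e) \<and>
        (hi x = lo y \<or> hi y = lo x)"
    and original_arcs_iff: "x \<in> pverts G \<Longrightarrow> y \<in> pverts G \<Longrightarrow>
      (x, y) \<in> parcs H \<longleftrightarrow> (x, y) \<in> parcs G \<and> (\<forall>w\<in>pverts H - pverts G. cl w \<noteq> {x, y})"

text \<open>Turning the layout upside down reduces a subdivision below a vertex to one above it.\<close>

lemma layout_mirror:
  assumes "layout G z H lo hi cl"
  shows "layout G (\<lambda>x. - z x) H (\<lambda>x. - hi x) (\<lambda>x. - lo x) cl"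
proof -
  interpret layout G z H lo hi cl by fact
  show ?thesis
  proof (rule layout.intro)
    fix x y e assume "x \<in> pverts H" "y \<in> pverts H" "x \<noteq> y" "in_column G cl x e" "in_column G cl y e"
    then show "- lo x \<le> - hi y \<or> - lo y \<le> - hi x" using ordered[of x y e] by auto
  next
    fix x y x' e h assume "x \<in> pverts H" "y \<in> pverts H" "x' \<in> pverts H"
      "x \<noteq> y" "y \<noteq> x'" "x \<noteq> x'" "in_column G cl x e" "in_column G cl y e" "in_column G cl x' e"
      "h \<in> {- hi x..- lo x}" "h \<in> {- hi y..- lo y}"
    then show "h \<notin> {- hi x'..- lo x'}" using no_triple[of x y x' e "- h"] by auto
  qed (use verts_subset original subdividing arcs_iff original_arcs_iff in auto)
qed

text \<open>The rectangle of \<open>u\<close> is cut: \<open>u\<close> keeps the lower part and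
  \<open>w\<close> takes the upper one, which touches \<open>v\<close>. All other contacts survive,
  because nothing but \<open>v\<close> rests on the top of \<open>u\<close> and nothing else in the
  column reaches the cut.\<close>

lemma layout_split_above:
  assumes L: "layout G z H lo hi cl" and GH: "pair_graph H"
    and uv: "(u, v) \<in> parcs H" and u: "u \<notin> pverts G" and w: "w \<notin> pverts H" and t: "hi u = lo v"
  shows "\<exists>lo hi cl. layout G z (subdivide H (u, v) w) lo hi cl"
proof -
  interpret H: pair_graph H by fact
  note sub = layout.verts_subset[OF L] and Z = layout.original[OF L] and W = layout.subdividing[OF L]
    and D = layout.ordered[OF L] and T = layout.no_triple[OF L]
    and A = layout.arcs_iff[OF L] and B = layout.original_arcs_iff[OF L]
  have le: "lo x \<le> hi x" if "x \<in> pverts H" for x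
    using Z[of x] W[OF that] by (cases "x \<in> pverts G") auto
  have vH: "v \<in> pverts H" "u \<in> pverts H" "u \<noteq> v"
    using uv H.in_arcsD1 H.in_arcsD2 H.no_loops' by blast+
  \<comment> \<open>Any height strictly between \<open>lo u\<close> and \<open>hi u\<close> would
    serve.\<close>
  define m where "m = (lo u + hi u) / 2"
  have m: "lo u < m" "m < hi u" using W[OF vH(2) u] by (auto simp: m_def)
  define lo' where "lo' = lo(w := m)"
  define hi' where "hi' = hi(u := m, w := hi u)"
  define cl' where "cl' = cl(w := cl u)"
  \<comment> \<open>\<open>p\<close> sends \<open>w\<close> back to the rectangle it was cut from.
    New intervals lie inside the old interval of their image, so the old conditions carry over to
    all pairs that \<open>p\<close> keeps apart; only \<open>u\<close> and \<open>w\<close> need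
    extra care.\<close>
  define p where "p x = (if x = w then u else x)" for x
  let ?H' = "subdivide H (u, v) w"
  have wG: "w \<notin> pverts G" "w \<noteq> u" "w \<noteq> v" using w sub vH by auto
  have col: "in_column G cl' x e \<longleftrightarrow> in_column G cl (p x) e" for x e
    using wG u by (auto simp: in_column_def cl'_def p_def)
  have pH: "p x \<in> pverts H" if "x \<in> pverts ?H'" for x
    using that vH by (auto simp: p_def)
  have lohi: "lo (p x) \<le> lo' x" "hi' x \<le> hi (p x)" for x
    using m wG by (auto simp: lo'_def hi'_def p_def)
  have peq: "(x = u \<and> y = w) \<or> (x = w \<and> y = u)" if "x \<noteq> y" "p x = p y" for x y
    using that by (auto simp: p_def split: if_splits)
  have colu: "in_column G cl u e \<longleftrightarrow> e = cl u" for e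
    using u W[OF vH(2) u] by (auto simp: in_column_def)
  have vcol: "in_column G cl v (cl u)" using A[OF vH(2,1)] u uv colu by auto
  \<comment> \<open>A third interval starting at \<open>hi u\<close> would share this height with
    \<open>u\<close> and \<open>v\<close>, against \<open>no_triple\<close>.\<close>
  have no1: "lo y \<noteq> hi u" if "y \<in> pverts H" "y \<noteq> u" "y \<noteq> v" "in_column G cl y (cl u)" for y
    using T[of u v y "cl u" "hi u"] that vH colu vcol t le[of v] le[of u] le[of y] by force
  have no2: "lo y \<noteq> m \<and> hi y \<noteq> m" "hi y < m \<or> m < lo y"
    if "y \<in> pverts H" "y \<noteq> u" "in_column G cl y (cl u)" for y
    using D[of u y "cl u"] that vH colu m le[of y] by force+
  have S: "(x, y) \<in> parcs H \<longleftrightarrow> (y, x) \<in> parcs H" for x y using H.arcs_symmetric by blast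
  have "layout G z ?H' lo' hi' cl'"
  proof (rule layout.intro)
    show "pverts G \<subseteq> pverts ?H'" using sub by auto
    fix x assume "x \<in> pverts G"
    then show "lo' x = z x \<and> hi' x = z x" using Z[of x] u wG by (auto simp: lo'_def hi'_def)
  next
    fix x assume "x \<in> pverts ?H'" "x \<notin> pverts G"
    then show "lo' x < hi' x \<and> cl' x \<in> edge_set G"
      using W[of x] W[of u] u vH m by (auto simp: lo'_def hi'_def cl'_def)
  next
    fix x y e assume xy: "x \<in> pverts ?H'" "y \<in> pverts ?H'" "x \<noteq> y"
      and c: "in_column G cl' x e" "in_column G cl' y e"
    show "hi' x \<le> lo' y \<or> hi' y \<le> lo' x"
    proof (cases "p x = p y")
      case True
      with peq[OF xy(3)] wG show ?thesis by (auto simp: lo'_def hi'_def)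
    next
      case False
      then show ?thesis using D[of "p x" "p y" e] c xy pH col lohi[of x] lohi[of y] by force
    qed
  next
    fix x y x' e h assume xy: "x \<in> pverts ?H'" "y \<in> pverts ?H'" "x' \<in> pverts ?H'"
      and ne: "x \<noteq> y" "y \<noteq> x'" "x \<noteq> x'"
      and c: "in_column G cl' x e" "in_column G cl' y e" "in_column G cl' x' e"
      and h: "h \<in> {lo' x..hi' x}" "h \<in> {lo' y..hi' y}"
    \<comment> \<open>If two of the three intervals are the halves \<open>u\<close> and
      \<open>w\<close>, the common height is the cut \<open>m\<close>, which the third one avoids by
      \<open>no2\<close>.\<close>
    have two: False if "a \<noteq> b" "p a = p b" "d \<noteq> a" "d \<noteq> b" "d \<in> pverts ?H'" "in_column G cl' d e"
      "in_column G cl' a e" "h \<in> {lo' a..hi' a}" "h \<in> {lo' b..hi' b}" "h \<in> {lo' d..hi' d}" for a b d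
    proof -
      have ab: "(a = u \<and> b = w) \<or> (a = w \<and> b = u)" using peq that by blast
      then have d: "d \<in> pverts H" "d \<noteq> u" "d \<noteq> w" using that by auto
      have "e = cl u" using that(7) ab colu[of e] by (auto simp: col p_def)
      then have "in_column G cl d (cl u)" using that(6) d by (auto simp: col p_def)
      moreover have "h = m" using ab that wG by (auto simp: lo'_def hi'_def)
      ultimately show False using no2(2)[OF d(1,2)] that(10) d by (auto simp: lo'_def hi'_def)
    qed
    show "h \<notin> {lo' x'..hi' x'}"
    proof
      assume h': "h \<in> {lo' x'..hi' x'}"
      have "p x \<noteq> p y" using two[of x y x'] ne xy c h h' by blast
      moreover have "p y \<noteq> p x'" using two[of y x' x] ne xy c h h' by blast
      moreover have "p x \<noteq> p x'" using two[of x x' y] ne xy c h h' by blast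
      ultimately show False
        using T[of "p x" "p y" "p x'" e h] xy pH c col h h' lohi[of x] lohi[of y] lohi[of x']
        by force
    qed
  next
    fix x y assume xy: "x \<in> pverts ?H'" "y \<in> pverts ?H'" and out: "x \<notin> pverts G \<or> y \<notin> pverts G"
    let ?t = "\<lambda>x y. x \<noteq> y \<and> (\<exists>e. in_column G cl' x e \<and> in_column G cl' y e) \<and> (hi' x = lo' y \<or> hi' y = lo' x)"
    have ts: "?t x y \<longleftrightarrow> ?t y x" for x y by auto
    have ps: "(x, y) \<in> parcs ?H' \<longleftrightarrow> (y, x) \<in> parcs ?H'" for x y using S by auto
    have W: "(w, y) \<in> parcs ?H' \<longleftrightarrow> ?t w y" if y: "y \<in> pverts ?H'" for y
    proof -
      have a: "(w, y) \<in> parcs ?H' \<longleftrightarrow> y = u \<or> y = v" using w by (auto dest: H.in_arcsD1)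
      consider "y = u" | "y = v" | "y = w" | "y \<in> pverts H" "y \<noteq> u" "y \<noteq> v" "y \<noteq> w" using y by auto
      then show ?thesis
      proof cases
        case 1 then show ?thesis using wG colu unfolding a col by (auto simp: p_def lo'_def hi'_def)
      next
        case 2 then show ?thesis using wG vcol colu t vH(3) unfolding a col by (auto simp: p_def lo'_def hi'_def)
      next
        case 3 then show ?thesis using wG unfolding a by auto
      next
        case 4
        then show ?thesis using no1[of y] no2(1)[of y] colu wG unfolding a col
          by (auto simp: p_def lo'_def hi'_def)
      qed
    qed
    have U: "(u, y) \<in> parcs ?H' \<longleftrightarrow> ?t u y" if "y \<in> pverts H" for y
    proof -
      have a: "(u, y) \<in> parcs ?H' \<longleftrightarrow> y \<noteq> v \<and> (u, y) \<in> parcs H"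
        using that w wG vH by auto
      show ?thesis
      proof (cases "y = v")
        case True
        then show ?thesis using a le[OF vH(1)] t m vH wG by (auto simp: lo'_def hi'_def)
      next
        case False
        have yw: "y \<noteq> w" using that w by auto
        have "?t u y \<longleftrightarrow> u \<noteq> y \<and> in_column G cl y (cl u) \<and> (m = lo y \<or> hi y = lo u)"
          using yw wG colu unfolding col by (auto simp: p_def lo'_def hi'_def)
        \<comment> \<open>Lowering the top of \<open>u\<close> from \<open>hi u\<close> to
          \<open>m\<close> creates no contact by \<open>no2\<close>, and by \<open>no1\<close> it
          loses none except the one with \<open>v\<close>, excluded here.\<close>
        also have "\<dots> \<longleftrightarrow> u \<noteq> y \<and> in_column G cl y (cl u) \<and> (hi u = lo y \<or> hi y = lo u)"
          using no1[OF that] no2(1)[OF that] False by auto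
        also have "\<dots> \<longleftrightarrow> (u, y) \<in> parcs H"
          using A[OF vH(2) that] u colu by auto
        finally show ?thesis using a False by simp
      qed
    qed
    show "(x, y) \<in> parcs ?H' \<longleftrightarrow> ?t x y"
    proof (cases "x = w \<or> y = w")
      case True then show ?thesis using W[of x] W[of y] xy ts ps by blast
    next
      case F: False
      then have xyH: "x \<in> pverts H" "y \<in> pverts H" using xy by auto
      show ?thesis
      proof (cases "x = u \<or> y = u")
        case True then show ?thesis using U[OF xyH(1)] U[OF xyH(2)] ts ps by blast
      next
        case False
        then have "(x, y) \<in> parcs ?H' \<longleftrightarrow> (x, y) \<in> parcs H" using F by auto
        also have "\<dots> \<longleftrightarrow> ?t x y"
          using A[OF xyH out] F False by (auto simp: col p_def lo'_def hi'_def)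
        finally show ?thesis .
      qed
    qed
  next
    fix x y assume "x \<in> pverts G" "y \<in> pverts G"
    moreover from this have "(x, y) \<in> parcs ?H' \<longleftrightarrow> (x, y) \<in> parcs H" using u wG by auto
    moreover have "(\<forall>w\<in>pverts ?H' - pverts G. cl' w \<noteq> {x, y}) \<longleftrightarrow> (\<forall>w\<in>pverts H - pverts G. cl w \<noteq> {x, y})"
      using wG w u vH by (auto simp: cl'_def)
    ultimately show "(x, y) \<in> parcs ?H' \<longleftrightarrow>
        (x, y) \<in> parcs G \<and> (\<forall>w\<in>pverts ?H' - pverts G. cl' w \<noteq> {x, y})"
      using B by blast
  qed
  then show ?thesis by blast
qed

text \<open>An arc of \<open>H\<close> between two vertices of \<open>G\<close> is an edge that no
  step has touched, by the last condition of \<open>layout\<close>. Its column holds only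
  \<open>u\<close> and \<open>v\<close>, at distinct heights since \<open>z\<close> is injective,
  and \<open>w\<close> fills the whole gap.\<close>

lemma layout_fill:
  assumes L: "layout G z H lo hi cl" and GH: "pair_graph H" and z: "inj_on z (pverts G)"
    and uv: "(u, v) \<in> parcs H" and u: "u \<in> pverts G" "v \<in> pverts G" and w: "w \<notin> pverts H"
  shows "\<exists>lo hi cl. layout G z (subdivide H (u, v) w) lo hi cl"
proof -
  interpret H: pair_graph H by fact
  note sub = layout.verts_subset[OF L] and Z = layout.original[OF L] and W = layout.subdividing[OF L]
    and D = layout.ordered[OF L] and T = layout.no_triple[OF L]
    and A = layout.arcs_iff[OF L] and B = layout.original_arcs_iff[OF L]
  have uG: "(u, v) \<in> parcs G" and free: "\<And>x. x \<in> pverts H \<Longrightarrow> x \<notin> pverts G \<Longrightarrow> cl x \<noteq> {u, v}"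
    using B[OF u] uv by auto
  have wG: "w \<notin> pverts G" "w \<noteq> u" "w \<noteq> v" "u \<noteq> v" using w sub u H.no_loops'[OF uv] by auto
  define lo' where "lo' = lo(w := min (z u) (z v))"
  define hi' where "hi' = hi(w := max (z u) (z v))"
  define cl' where "cl' = cl(w := {u, v})"
  let ?H' = "subdivide H (u, v) w"
  have zne: "z u \<noteq> z v" using z wG u by (auto dest: inj_onD)
  have e: "{u, v} \<in> edge_set G" using uG by (auto simp: edge_set_def)
  have colw: "in_column G cl' w e \<longleftrightarrow> e = {u, v}" for e
    using wG e by (auto simp: in_column_def cl'_def)
  have col: "in_column G cl' x e \<longleftrightarrow> in_column G cl x e" if "x \<noteq> w" for x e
    using that by (auto simp: in_column_def cl'_def)
  have full: "x = u \<or> x = v" if "x \<in> pverts H" "in_column G cl x {u, v}" for x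
    using that free[of x] by (auto simp: in_column_def split: if_splits)
  have fullI: "in_column G cl u {u, v}" "in_column G cl v {u, v}"
    using e u by (auto simp: in_column_def)
  have val: "lo u = z u" "hi u = z u" "lo v = z v" "hi v = z v" using Z u by auto
  have S: "(x, y) \<in> parcs H \<longleftrightarrow> (y, x) \<in> parcs H" for x y using H.arcs_symmetric by blast
  have "layout G z ?H' lo' hi' cl'"
  proof (rule layout.intro)
    show "pverts G \<subseteq> pverts ?H'" using sub by auto
    fix x assume "x \<in> pverts G"
    then show "lo' x = z x \<and> hi' x = z x" using Z[of x] wG by (auto simp: lo'_def hi'_def)
  next
    fix x assume "x \<in> pverts ?H'" "x \<notin> pverts G"
    then show "lo' x < hi' x \<and> cl' x \<in> edge_set G"
      using W[of x] zne e by (auto simp: lo'_def hi'_def cl'_def)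
  next
    fix x y e assume xy: "x \<in> pverts ?H'" "y \<in> pverts ?H'" "x \<noteq> y"
      and c: "in_column G cl' x e" "in_column G cl' y e"
    consider "x = w" | "y = w" | "x \<noteq> w" "y \<noteq> w" by blast
    then show "hi' x \<le> lo' y \<or> hi' y \<le> lo' x"
    proof cases
      case 1
      then have "y = u \<or> y = v" using full[of y] col[of y] xy c colw by auto
      then show ?thesis using 1 wG val by (auto simp: lo'_def hi'_def)
    next
      case 2
      then have "x = u \<or> x = v" using full[of x] col[of x] xy c colw by auto
      then show ?thesis using 2 wG val by (auto simp: lo'_def hi'_def)
    next
      case 3
      then show ?thesis using D[of x y e] c xy col by (auto simp: lo'_def hi'_def)
    qed
  next
    fix x y x' e h assume xy: "x \<in> pverts ?H'" "y \<in> pverts ?H'" "x' \<in> pverts ?H'"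
      and ne: "x \<noteq> y" "y \<noteq> x'" "x \<noteq> x'"
      and c: "in_column G cl' x e" "in_column G cl' y e" "in_column G cl' x' e"
      and h: "h \<in> {lo' x..hi' x}" "h \<in> {lo' y..hi' y}"
    \<comment> \<open>If \<open>w\<close> is one of the three, the other two must be
      \<open>u\<close> and \<open>v\<close>, whose intervals are different points.\<close>
    have two: False if "a \<in> pverts ?H'" "b \<in> pverts ?H'" "a \<noteq> b" "a \<noteq> w" "b \<noteq> w"
      "in_column G cl' w e" "in_column G cl' a e" "in_column G cl' b e"
      "h \<in> {lo' a..hi' a}" "h \<in> {lo' b..hi' b}" for a b
    proof -
      have "e = {u, v}" using that(6) colw by simp
      then have "a = u \<or> a = v" "b = u \<or> b = v" using full that col by auto
      then show False using that zne val by (auto simp: lo'_def hi'_def)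
    qed
    show "h \<notin> {lo' x'..hi' x'}"
    proof
      assume h': "h \<in> {lo' x'..hi' x'}"
      have "x \<noteq> w" using two[of y x'] ne xy c h h' by blast
      moreover have "y \<noteq> w" using two[of x x'] ne xy c h h' by blast
      moreover have "x' \<noteq> w" using two[of x y] ne xy c h h' by blast
      ultimately show False
        using T[of x y x' e h] ne xy c col h h' by (simp add: lo'_def hi'_def)
    qed
  next
    fix x y assume xy: "x \<in> pverts ?H'" "y \<in> pverts ?H'" and out: "x \<notin> pverts G \<or> y \<notin> pverts G"
    let ?t = "\<lambda>x y. x \<noteq> y \<and> (\<exists>e. in_column G cl' x e \<and> in_column G cl' y e) \<and> (hi' x = lo' y \<or> hi' y = lo' x)"
    have ts: "?t x y \<longleftrightarrow> ?t y x" for x y by auto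
    have ps: "(x, y) \<in> parcs ?H' \<longleftrightarrow> (y, x) \<in> parcs ?H'" for x y using S by auto
    have W: "(w, y) \<in> parcs ?H' \<longleftrightarrow> ?t w y" if y: "y \<in> pverts ?H'" for y
    proof -
      have a: "(w, y) \<in> parcs ?H' \<longleftrightarrow> y = u \<or> y = v" using w by (auto dest: H.in_arcsD1)
      consider "y = u" | "y = v" | "y = w" | "y \<in> pverts H" "y \<noteq> u" "y \<noteq> v" "y \<noteq> w" using y by auto
      then show ?thesis
      proof cases
        case 1 then show ?thesis using wG colw col fullI val unfolding a
          by (auto simp: lo'_def hi'_def min_def max_def)
      next
        case 2 then show ?thesis using wG colw col fullI val unfolding a
          by (auto simp: lo'_def hi'_def min_def max_def)
      next
        case 3 then show ?thesis using wG unfolding a by auto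
      next
        case 4
        then show ?thesis using full[of y] wG colw col unfolding a by auto
      qed
    qed
    show "(x, y) \<in> parcs ?H' \<longleftrightarrow> ?t x y"
    proof (cases "x = w \<or> y = w")
      case True then show ?thesis using W[of x] W[of y] xy ts ps by blast
    next
      case F: False
      then have xyH: "x \<in> pverts H" "y \<in> pverts H" using xy by auto
      have "(x, y) \<in> parcs ?H' \<longleftrightarrow> (x, y) \<in> parcs H" using F out u by auto
      also have "\<dots> \<longleftrightarrow> ?t x y"
        using A[OF xyH out] F by (auto simp: col lo'_def hi'_def)
      finally show ?thesis .
    qed
  next
    fix x y assume xy: "x \<in> pverts G" "y \<in> pverts G"
    have "(x, y) \<in> parcs ?H' \<longleftrightarrow> (x, y) \<in> parcs H \<and> {x, y} \<noteq> {u, v}"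
      using xy wG by (auto simp: doubleton_eq_iff)
    moreover have "(\<forall>w\<in>pverts ?H' - pverts G. cl' w \<noteq> {x, y}) \<longleftrightarrow>
        (\<forall>w\<in>pverts H - pverts G. cl w \<noteq> {x, y}) \<and> {x, y} \<noteq> {u, v}"
      using wG w by (auto simp: cl'_def)
    ultimately show "(x, y) \<in> parcs ?H' \<longleftrightarrow>
        (x, y) \<in> parcs G \<and> (\<forall>w\<in>pverts ?H' - pverts G. cl' w \<noteq> {x, y})"
      using B[OF xy] by blast
  qed
  then show ?thesis by blast
qed

lemma layout_split:
  assumes L: "layout G z H lo hi cl" and GH: "pair_graph H"
    and uv: "(u, v) \<in> parcs H" and u: "u \<notin> pverts G" and w: "w \<notin> pverts H"
  shows "\<exists>lo hi cl. layout G z (subdivide H (u, v) w) lo hi cl"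
proof -
  interpret H: pair_graph H by fact
  have "u \<in> pverts H" "v \<in> pverts H" using uv H.in_arcsD1 H.in_arcsD2 by blast+
  then consider "hi u = lo v" | "hi v = lo u" using layout.arcs_iff[OF L, of u v] uv u by blast
  then show ?thesis
  proof cases
    case 1
    then show ?thesis using layout_split_above[OF L GH uv u w] by blast
  next
    case 2
    have "\<exists>lo hi cl. layout G (\<lambda>x. - z x) (subdivide H (u, v) w) lo hi cl"
      by (rule layout_split_above[OF layout_mirror[OF L] GH uv u w]) (simp add: 2)
    then show ?thesis using layout_mirror by fastforce
  qed
qed

lemma layout_subdivide:
  assumes L: "layout G z H lo hi cl" and GH: "pair_graph H" and z: "inj_on z (pverts G)"
    and uv: "(u, v) \<in> parcs H" and w: "w \<notin> pverts H"
  shows "\<exists>lo hi cl. layout G z (subdivide H (u, v) w) lo hi cl"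
proof -
  interpret H: pair_graph H by fact
  have vu: "(v, u) \<in> parcs H" using uv H.arcs_symmetric by blast
  have swap: "subdivide H (v, u) w = subdivide H (u, v) w"
    by (auto simp: subdivide.simps)
  consider "u \<in> pverts G" "v \<in> pverts G" | "u \<notin> pverts G" | "v \<notin> pverts G" by blast
  then show ?thesis
  proof cases
    case 1 then show ?thesis using layout_fill[OF L GH z uv _ _ w] by blast
  next
    case 2 then show ?thesis using layout_split[OF L GH uv _ w] by blast
  next
    case 3 then show ?thesis using layout_split[OF L GH vu _ w] unfolding swap by blast
  qed
qed

lemma layout_exists:
  assumes G: "pair_graph G" and z: "inj_on z (pverts G)" and H: "subdivision_pair G H"
  shows "\<exists>lo hi cl. layout G z H lo hi cl"
  using H
proof (induction rule: subdivision_pair_induct)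
  case base
  interpret G: pair_graph G by fact
  \<comment> \<open>The labelling is arbitrary here, as there are no subdividing vertices yet.
    Injectivity of \<open>z\<close> excludes common heights.\<close>
  have "layout G z G z z (\<lambda>_. {})" 
    by unfold_locales (auto dest: inj_onD[OF z])
  then show ?case by blast
next
  case (divide e w H)
  then obtain lo hi cl where "layout G z H lo hi cl" by blast
  moreover have "pair_graph H" using divide pair_graph.pair_graph_subdivision[OF G] by blast
  ultimately show ?case using divide layout_subdivide[OF _ _ z] by (cases e) blast
qed


section \<open>Chains of supported corners\<close>

text \<open>The left side is a face of the hull, and a face of a polytope is spanned by some of the
  generators. This serves for the sides of a polygon, for its trace on a wall, and for the top and
  bottom of a rectangle.\<close>

lemma convex_hull_Int_supporting_hyperplane:
  fixes A :: "'a::euclidean_space set"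
  assumes "finite A" and "\<And>x. x \<in> A \<Longrightarrow> c \<le> n \<bullet> x"
  shows "convex hull A \<inter> {x. n \<bullet> x = c} = convex hull (A \<inter> {x. n \<bullet> x = c})"
proof
  have "convex hull A \<subseteq> {x. c \<le> n \<bullet> x}"
    using assms(2) by (intro hull_minimal) (auto simp: convex_halfspace_ge)
  then have "(convex hull A \<inter> {x. n \<bullet> x = c}) face_of convex hull A"
    by (intro face_of_Int_supporting_hyperplane_ge) auto
  then obtain A' where A': "A' \<subseteq> A" "convex hull A \<inter> {x. n \<bullet> x = c} = convex hull A'"
    using face_of_convex_hull_subset finite_imp_compact[OF assms(1)] by metis
  then have "A' \<subseteq> A \<inter> {x. n \<bullet> x = c}" using hull_subset[of A' convex] by auto
  then show "convex hull A \<inter> {x. n \<bullet> x = c} \<subseteq> convex hull (A \<inter> {x. n \<bullet> x = c})"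
    using A'(2) hull_mono by metis
  have "convex hull (A \<inter> {x. n \<bullet> x = c}) \<subseteq> convex hull A" by (simp add: hull_mono)
  moreover have "convex hull (A \<inter> {x. n \<bullet> x = c}) \<subseteq> {x. n \<bullet> x = c}"
    by (intro hull_minimal) (auto simp: convex_hyperplane)
  ultimately show "convex hull (A \<inter> {x. n \<bullet> x = c}) \<subseteq> convex hull A \<inter> {x. n \<bullet> x = c}" by blast
qed

text \<open>A certificate for strict convexity: each side has a supporting plane that contains its
  two ends and no further corner. The normal \<open>n i\<close> need not be parallel to the plane of
  the polygon, which keeps the concrete normals simple.\<close>

locale supported_chain =
  fixes P :: "(real^3) list" and n :: "nat \<Rightarrow> real^3" and c :: "nat \<Rightarrow> real"
  assumes len: "3 \<le> length P"
    and coplanar: "coplanar (set P)"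
    and support: "i < length P \<Longrightarrow> k < length P \<Longrightarrow> c i \<le> n i \<bullet> P ! k"
    and support_eq: "i < length P \<Longrightarrow> k < length P \<Longrightarrow>
      n i \<bullet> P ! k = c i \<longleftrightarrow> k = i \<or> k = Suc i mod length P"
begin

abbreviation "K \<equiv> convex hull set P"

text \<open>The half-plane description of the polygon. It turns out to equal \<open>K\<close>, and
  it is the form in which the boundary and the components of its complement can be
  controlled.\<close>

definition envelope :: "(real^3) set" where
  "envelope = {x \<in> affine hull set P. \<forall>i<length P. c i \<le> n i \<bullet> x}"

lemma next_less: "Suc i mod length P < length P"
  using len by (intro mod_less_divisor) linarith

lemma next_neq:
  assumes "i < length P"
  shows "Suc i mod length P \<noteq> i" "Suc (Suc i) mod length P \<noteq> i"
    "Suc (Suc i) mod length P \<noteq> Suc i mod length P"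
  using assms len by (auto simp: mod_Suc)

lemma next_next: "Suc (Suc i mod length P) mod length P = Suc (Suc i) mod length P"
  by (simp add: mod_Suc_eq)

lemma support_less:
  assumes "i < length P" "k < length P" "k \<noteq> i" "k \<noteq> Suc i mod length P"
  shows "c i < n i \<bullet> P ! k"
  using support[OF assms(1,2)] support_eq[OF assms(1,2)] assms(3,4) by linarith

lemma in_set_support: "x \<in> set P \<Longrightarrow> i < length P \<Longrightarrow> c i \<le> n i \<bullet> x"
  using support by (auto simp: in_set_conv_nth)

text \<open>If corners \<open>i\<close> and \<open>j\<close> coincide, each lies on the supporting
  plane of the other, so each index is the cyclic successor of the other; this needs a cycle of
  length two.\<close>

lemma distinct: "distinct P"
  unfolding distinct_conv_nth
proof (intro allI impI notI)
  fix i j assume ij: "i < length P" "j < length P" "i \<noteq> j" and eq: "P ! i = P ! j"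
  have "j = Suc i mod length P" using support_eq[of i j] support_eq[of i i] ij eq by auto
  moreover have "i = Suc j mod length P" using support_eq[of j i] support_eq[of j j] ij eq by auto
  ultimately show False using next_next[of i] next_neq[of i] ij by auto
qed

lemma corners_on_hyperplane:
  assumes "i < length P"
  shows "set P \<inter> {x. n i \<bullet> x = c i} = {P ! i, next_corner P i}"
  using assms next_less[of i] support_eq by (auto simp: in_set_conv_nth next_corner_def)

lemma side_eq_face:
  assumes "i < length P"
  shows "K \<inter> {x. n i \<bullet> x = c i} = side P i"
  using convex_hull_Int_supporting_hyperplane[of "set P" "c i" "n i"] in_set_support assms
    corners_on_hyperplane[OF assms]
  by (simp add: side_def segment_convex_hull)

lemma side_subset: "i < length P \<Longrightarrow> side P i \<subseteq> K"
  using side_eq_face by blast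

text \<open>Cutting side \<open>i\<close> with the supporting plane of side \<open>j\<close> leaves
  the hull of the corners they share. Two different sides share at most one corner, so taking the
  hull adds nothing.\<close>

lemma side_Int_side:
  assumes "i < length P" "j < length P" "i \<noteq> j"
  shows "side P i \<inter> side P j = {P ! i, next_corner P i} \<inter> {P ! j, next_corner P j}"
proof -
  let ?A = "{P ! i, next_corner P i}" and ?B = "{P ! j, next_corner P j}"
  have sub: "?A \<subseteq> set P" using assms next_less by (auto simp: next_corner_def)
  have "side P i \<inter> side P j = side P i \<inter> {x. n j \<bullet> x = c j}"
    using side_eq_face side_subset assms by blast
  also have "\<dots> = convex hull (?A \<inter> {x. n j \<bullet> x = c j})"
    unfolding side_def segment_convex_hull using sub in_set_support[OF _ assms(2)]
    by (intro convex_hull_Int_supporting_hyperplane) auto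
  also have "?A \<inter> {x. n j \<bullet> x = c j} = ?A \<inter> ?B"
    using corners_on_hyperplane[OF assms(2)] sub by blast
  also have "convex hull (?A \<inter> ?B) = ?A \<inter> ?B"
  proof -
    have "?A \<noteq> ?B"
    proof
      assume eq: "?A = ?B"
      have "P ! i \<noteq> P ! j" using distinct assms by (simp add: nth_eq_iff_index_eq)
      then have "P ! i = next_corner P j" "P ! j = next_corner P i" using eq by (auto simp: doubleton_eq_iff)
      then have "i = Suc j mod length P" "j = Suc i mod length P"
        using distinct assms next_less by (simp_all add: next_corner_def nth_eq_iff_index_eq)
      then show False using next_next[of i] next_neq[of i] assms by auto
    qed
    then have "?A \<inter> ?B = {} \<or> (\<exists>a. ?A \<inter> ?B = {a})"
      by (cases "P ! i \<in> ?B"; cases "next_corner P i \<in> ?B") auto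
    then show ?thesis by (elim disjE exE) (simp_all only: convex_hull_empty convex_hull_singleton)
  qed
  finally show ?thesis .
qed

lemma polygon: "polygon P"
  using len distinct side_Int_side coplanar by (simp add: polygon_def simple_closed_chain_def)

lemma not_collinear:
  assumes i: "i < length P"
  shows "\<not> collinear {P ! i, next_corner P i, next_corner P (Suc i)}"
proof
  assume "collinear {P ! i, next_corner P i, next_corner P (Suc i)}"
  moreover have "P ! i \<noteq> next_corner P i"
    using distinct i next_less next_neq[OF i] by (simp add: next_corner_def nth_eq_iff_index_eq)
  ultimately have "next_corner P (Suc i) \<in> affine hull {P ! i, next_corner P i}"
    by (rule collinear_3_imp_in_affine_hull)
  also have "\<dots> \<subseteq> {x. n i \<bullet> x = c i}"
    using corners_on_hyperplane[OF i] by (intro hull_minimal) (auto simp: affine_hyperplane)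
  finally have "n i \<bullet> P ! (Suc (Suc i) mod length P) = c i" by (simp add: next_corner_def)
  then show False using support_eq[OF i next_less] next_neq[OF i] by auto
qed

section \<open>The polygon as an intersection of half-planes\<close>

text \<open>Three consecutive corners already span dimension 2, the most that coplanarity permits.
  They can thus serve as affine coordinates.\<close>

lemma affine_hull_eq:
  assumes i: "i < length P"
  shows "affine hull set P = affine hull {P ! i, next_corner P i, next_corner P (Suc i)}"
    (is "_ = affine hull ?T")
proof (rule sym, rule affine_dim_equal)
  have "?T \<subseteq> set P" using i next_less by (auto simp: next_corner_def)
  then show sub: "affine hull ?T \<subseteq> affine hull set P" by (rule hull_mono)
  obtain u v w where "set P \<subseteq> affine hull {u, v, w}" using coplanar by (auto simp: coplanar_def)
  then have "aff_dim (set P) \<le> aff_dim {u, v, w}" using aff_dim_subset aff_dim_affine_hull by metis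
  also have "\<dots> \<le> 2" using aff_dim_le_card[of "{u, v, w}"] card_length[of "[u, v, w]"] by simp
  finally have "aff_dim (set P) \<le> 2" .
  moreover have "aff_dim ?T = 2"
  proof -
    have "\<not> affine_dependent ?T" "card ?T = 3"
      using not_collinear[OF i] by (auto simp: collinear_3_eq_affine_dependent)
    then show ?thesis using aff_dim_affine_independent[of ?T] by simp
  qed
  ultimately show "aff_dim (affine hull ?T) = aff_dim (affine hull set P)"
    using aff_dim_subset[OF sub] by simp
qed auto

text \<open>In affine coordinates for the corners \<open>i\<close>, \<open>i + 1\<close>,
  \<open>i + 2\<close> (cyclically), equality for side \<open>i\<close> kills the third coordinate.
  The inequalities of the two neighbouring sides confine the point to the segment.\<close>

lemma envelope_Int_hyperplane:
  assumes y: "y \<in> envelope" and i: "i < length P" and eq: "n i \<bullet> y = c i"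
  shows "y \<in> side P i"
proof -
  let ?j = "Suc i mod length P" and ?k = "Suc (Suc i) mod length P"
  \<comment> \<open>The cyclic predecessor of \<open>i\<close>, which wraps around for
    \<open>i = 0\<close>.\<close>
  obtain l where l: "l < length P" "Suc l mod length P = i"
  proof (cases i)
    case 0
    have "Suc (length P - 1) = length P" using len by linarith
    then show ?thesis using that[of "length P - 1"] 0 i by simp
  next
    case (Suc m) then show ?thesis using that[of m] i by auto
  qed
  have "y \<in> affine hull {P ! i, P ! ?j, P ! ?k}"
    using y affine_hull_eq[OF i] by (simp add: envelope_def next_corner_def)
  then obtain a b d where abd: "a + b + d = 1" and y': "y = a *\<^sub>R P ! i + b *\<^sub>R P ! ?j + d *\<^sub>R P ! ?k"
    by (auto simp: affine_hull_3)
  have j: "?j < length P" "?k < length P" using next_less by auto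
  have "n i \<bullet> P ! i = c i" "n i \<bullet> P ! ?j = c i" "n i \<bullet> P ! ?k \<noteq> c i"
    using support_eq[OF i] i j next_neq[OF i] by auto
  then have "c i = (a + b) * c i + d * (n i \<bullet> P ! ?k)"
    using eq by (simp add: y' inner_add_right algebra_simps)
  also have "\<dots> = c i + d * (n i \<bullet> P ! ?k - c i)"
  proof -
    have a: "a = 1 - b - d" using abd by simp
    show ?thesis unfolding a by (simp add: algebra_simps)
  qed
  finally have "d = 0" using \<open>n i \<bullet> P ! ?k \<noteq> c i\<close> by simp
  then have y: "y = (1 - b) *\<^sub>R P ! i + b *\<^sub>R P ! ?j" and ge: "\<And>m. m < length P \<Longrightarrow> c m \<le> n m \<bullet> y"
    using y' abd y by (auto simp: envelope_def)
  \<comment> \<open>The following side is tight at its first corner \<open>?j\<close> and slack at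
    \<open>i\<close>, which bounds \<open>b\<close> above; the preceding side \<open>l\<close>
    bounds it below in the same way.\<close>
  have "n ?j \<bullet> P ! ?j = c ?j" "n ?j \<bullet> P ! i > c ?j"
    using support_eq[OF j(1,1)] support_less[OF j(1) i] next_neq[OF i] next_next[of i] by auto
  moreover have "0 \<le> (1 - b) * (n ?j \<bullet> P ! i - c ?j)"
    using ge[OF j(1)] calculation by (simp add: y inner_add_right algebra_simps)
  ultimately have "b \<le> 1" by (simp add: zero_le_mult_iff)
  have "?j \<noteq> l" using next_next[of l] next_neq[of l] l by auto
  then have "n l \<bullet> P ! i = c l" "n l \<bullet> P ! ?j > c l"
    using support_eq[OF l(1) i] support_less[OF l(1) j(1)] l next_neq[OF i] by auto
  moreover have "0 \<le> b * (n l \<bullet> P ! ?j - c l)"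
    using ge[OF l(1)] calculation by (simp add: y inner_add_right algebra_simps)
  ultimately have "0 \<le> b" by (simp add: zero_le_mult_iff)
  with \<open>b \<le> 1\<close> show ?thesis unfolding side_def closed_segment_def next_corner_def using y by blast
qed

text \<open>A ratio test: among the inequalities that decrease along \<open>b - a\<close>, the one
  with the least ratio \<open>t\<close> becomes tight first, and up to then all others still hold.
  The tight one puts the point on a side.\<close>

lemma exit_point:
  assumes y: "y \<in> envelope" and ab: "a \<in> set P" "b \<in> set P"
    and m: "m < length P" "n m \<bullet> (b - a) < 0"
  obtains s k where "0 \<le> s" "k < length P" "y + s *\<^sub>R (b - a) \<in> side P k"
proof -
  define w where "w = b - a"
  define I where "I = {i. i < length P \<and> n i \<bullet> w < 0}"
  define t where "t i = (n i \<bullet> y - c i) / (- (n i \<bullet> w))" for i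
  have "finite I" "I \<noteq> {}" using m by (auto simp: I_def w_def)
  then obtain k where k: "k \<in> I" and min: "\<And>i. i \<in> I \<Longrightarrow> t k \<le> t i"
    using ex_min_if_finite[of "t ` I"] by (force simp: not_less)
  have yge: "c i \<le> n i \<bullet> y" if "i < length P" for i using y that by (simp add: envelope_def)
  have t0: "0 \<le> t i" if "i \<in> I" for i
    using that yge[of i] by (auto simp: t_def I_def intro!: divide_nonneg_neg)
  have tk: "n k \<bullet> y + t k * (n k \<bullet> w) = c k" using k by (simp add: t_def I_def field_simps)
  have "y + t k *\<^sub>R w \<in> envelope" unfolding envelope_def
  proof (intro CollectI conjI allI impI)
    show "y + t k *\<^sub>R w \<in> affine hull set P" unfolding w_def
      using y ab hull_subset[of "set P" affine] by (intro mem_affine_3_minus) (auto simp: envelope_def)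
    fix i assume i: "i < length P"
    show "c i \<le> n i \<bullet> (y + t k *\<^sub>R w)"
    proof (cases "i \<in> I")
      case True
      then have "t k * (- (n i \<bullet> w)) \<le> t i * (- (n i \<bullet> w))"
        using min by (intro mult_right_mono) (auto simp: I_def)
      also have "\<dots> = n i \<bullet> y - c i" using True by (simp add: t_def I_def)
      finally show ?thesis by (simp add: inner_add_right)
    next
      case False
      then have "0 \<le> t k * (n i \<bullet> w)" using t0[OF k] i by (auto simp: I_def)
      then show ?thesis using yge[OF i] by (simp add: inner_add_right)
    qed
  qed
  moreover have "n k \<bullet> (y + t k *\<^sub>R w) = c k" using tk by (simp add: inner_add_right)
  moreover have "k < length P" using k by (simp add: I_def)
  ultimately show ?thesis using that[of "t k" k] t0[OF k] envelope_Int_hyperplane by (simp add: w_def)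
qed

text \<open>The line through a point of \<^term>\<open>envelope\<close> in the direction of the first side leaves \<^term>\<open>envelope\<close> on both
  ends, each time through a side.\<close>

lemma envelope_eq: "envelope = K"
proof
  show "K \<subseteq> envelope"
  proof
    fix x assume x: "x \<in> K"
    have "c i \<le> n i \<bullet> x" if "i < length P" for i
    proof -
      have "K \<subseteq> {x. c i \<le> n i \<bullet> x}"
        using in_set_support that by (intro hull_minimal) (auto simp: convex_halfspace_ge)
      then show ?thesis using x by blast
    qed
    then show "x \<in> envelope" using x convex_hull_subset_affine_hull[of "set P"] by (auto simp: envelope_def)
  qed
  show "envelope \<subseteq> K"
  proof
    fix y assume y: "y \<in> envelope"
    let ?a = "P ! 0" and ?b = "P ! 1" and ?l = "length P - 1"
    have ab: "?a \<in> set P" "?b \<in> set P" using len by (intro nth_mem; linarith)+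
    have l: "?l < length P" "1 < length P" "0 < length P" "Suc ?l = length P" using len by linarith+
    \<comment> \<open>Side 1 starts at \<open>?b\<close> and is slack at \<open>?a\<close>, so its
      inequality decreases along the first side. The last side ends at \<open>?a\<close> and does
      the same for the opposite direction.\<close>
    have "Suc 1 mod length P \<noteq> 0" using len by (simp add: mod_Suc)
    then have "n 1 \<bullet> ?b = c 1" "c 1 < n 1 \<bullet> ?a"
      using support_eq[OF l(2,2)] support_less[OF l(2,3)] by auto
    then have 1: "n 1 \<bullet> (?b - ?a) < 0" by (simp add: inner_diff_right)
    have "Suc ?l mod length P = 0" "1 \<noteq> ?l" using len l(4) by auto
    then have "n ?l \<bullet> ?a = c ?l" "c ?l < n ?l \<bullet> ?b"
      using support_eq[OF l(1,3)] support_less[OF l(1,2)] by auto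
    then have 2: "n ?l \<bullet> (?a - ?b) < 0" by (simp add: inner_diff_right)
    obtain s i where s: "0 \<le> s" "i < length P" "y + s *\<^sub>R (?b - ?a) \<in> side P i"
      using exit_point[OF y ab l(2) 1] by blast
    obtain t j where t: "0 \<le> t" "j < length P" "y + t *\<^sub>R (?a - ?b) \<in> side P j"
      using exit_point[OF y ab(2,1) l(1) 2] by blast
    define p q where "p = y + s *\<^sub>R (?b - ?a)" and "q = y + t *\<^sub>R (?a - ?b)"
    have pq: "p \<in> K" "q \<in> K" using subsetD[OF side_subset s(3)] subsetD[OF side_subset t(3)] s(2) t(2)
      by (simp_all add: p_def q_def)
    show "y \<in> K"
    proof (cases "s + t = 0")
      case True
      then have "p = y" using s t by (simp add: p_def)
      then show ?thesis using pq by simp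
    next
      case False
      then have st: "0 < s + t" using s t by simp
      have "(s + t) *\<^sub>R y = t *\<^sub>R p + s *\<^sub>R q"
        by (simp add: p_def q_def algebra_simps)
      then have "(1 / (s + t)) *\<^sub>R ((s + t) *\<^sub>R y) = (1 / (s + t)) *\<^sub>R (t *\<^sub>R p + s *\<^sub>R q)" by simp
      then have "y = (t / (s + t)) *\<^sub>R p + (s / (s + t)) *\<^sub>R q"
        using st by (simp add: scaleR_add_right)
      moreover have "\<dots> \<in> K"
        using pq s t st by (intro convexD[OF convex_convex_hull]) (auto simp flip: add_divide_distrib)
      ultimately show ?thesis by simp
    qed
  qed
qed

text \<open>Off the sides, no point of the plane satisfies all supporting inequalities unless it satisfies all of
  them strictly, so the interior is clopen.\<close>

lemma bounded_component:
  assumes x: "x \<in> K - \<Union>(sides P)"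
  shows "bounded (connected_component_set (affine hull set P - \<Union>(sides P)) x)"
proof -
  let ?S = "affine hull set P - \<Union>(sides P)"
  define U V where "U = (\<Inter>i\<in>{..<length P}. {y. n i \<bullet> y > c i})"
    and "V = (\<Union>i\<in>{..<length P}. {y. n i \<bullet> y < c i})"
  have op: "open U" "open V"
    unfolding U_def V_def by (auto intro!: open_INT open_UN simp: open_halfspace_gt open_halfspace_lt)
  have S: "y \<in> U \<or> y \<in> V" if "y \<in> ?S" for y
  proof (rule ccontr)
    assume "\<not> (y \<in> U \<or> y \<in> V)"
    then have nV: "\<And>i. i < length P \<Longrightarrow> c i \<le> n i \<bullet> y"
      and "\<exists>i<length P. n i \<bullet> y \<le> c i" unfolding U_def V_def by (auto simp: not_less)
    then obtain i where i: "i < length P" "n i \<bullet> y = c i" by (meson order_antisym)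
    have "y \<in> envelope" using that nV by (simp add: envelope_def)
    then have "y \<in> side P i" using i envelope_Int_hyperplane by blast
    then show False using that i by (auto simp: sides_def)
  qed
  let ?C = "connected_component_set ?S x"
  have xS: "x \<in> ?S" using x convex_hull_subset_affine_hull[of "set P"] by auto
  have "x \<in> U"
  proof -
    have "x \<in> envelope" using x envelope_eq by auto
    then have "x \<notin> V" by (auto simp: envelope_def V_def not_less)
    then show ?thesis using S[OF xS] by blast
  qed
  have CS: "?C \<subseteq> ?S" by (rule connected_component_subset)
  have "U \<inter> V = {}" by (auto simp: U_def V_def) (meson lessThan_iff less_asym)
  then have "U \<inter> ?C = {} \<or> V \<inter> ?C = {}"
    using connectedD[OF connected_connected_component[of ?S x] op] S CS by blast
  moreover have "x \<in> ?C" using xS by (simp add: connected_component_refl)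
  ultimately have "?C \<subseteq> U" using \<open>x \<in> U\<close> S CS by blast
  then have "?C \<subseteq> envelope" using CS by (force simp: envelope_def U_def)
  moreover have "bounded envelope" unfolding envelope_eq by (simp add: bounded_convex_hull finite_imp_bounded)
  ultimately show ?thesis using bounded_subset by blast
qed

text \<open>The ray from \<open>x\<close> away from a corner never enters \<open>K\<close>:
  otherwise \<open>x\<close> would lie between a point of \<open>K\<close> and that corner. So the
  whole ray stays in the component of \<open>x\<close>.\<close>

lemma unbounded_component:
  assumes x: "x \<in> affine hull set P" "x \<notin> K"
  shows "\<not> bounded (connected_component_set (affine hull set P - \<Union>(sides P)) x)"
proof
  let ?S = "affine hull set P - \<Union>(sides P)"
  assume "bounded (connected_component_set ?S x)"
  then obtain B where B: "\<And>y. y \<in> connected_component_set ?S x \<Longrightarrow> norm y \<le> B"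
    unfolding bounded_iff by blast
  let ?a = "P ! 0"
  let ?R = "(\<lambda>t. x + t *\<^sub>R (x - ?a)) ` {0..}"
  have a: "?a \<in> set P" using len by (intro nth_mem) linarith
  then have aK: "?a \<in> K" by (rule hull_inc)
  have "Topological_Spaces.connected ?R" by (intro connected_continuous_image continuous_intros convex_connected) simp
  moreover have "x \<in> ?R" by (force intro: image_eqI[of _ _ 0])
  moreover have "?R \<subseteq> ?S"
  proof (intro image_subsetI DiffI notI)
    fix t :: real assume t: "t \<in> {0..}"
    let ?y = "x + t *\<^sub>R (x - ?a)"
    show "?y \<in> affine hull set P"
      using x a hull_subset[of "set P" affine] by (intro mem_affine_3_minus) auto
    assume "?y \<in> \<Union>(sides P)"
    then have "?y \<in> K" using side_subset by (auto simp: sides_def)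
    moreover have "x = (1 / (1 + t)) *\<^sub>R ?y + (t / (1 + t)) *\<^sub>R ?a"
    proof -
      have "(1 + t) *\<^sub>R x = ?y + t *\<^sub>R ?a" by (simp add: algebra_simps)
      then have "(1 / (1 + t)) *\<^sub>R ((1 + t) *\<^sub>R x) = (1 / (1 + t)) *\<^sub>R (?y + t *\<^sub>R ?a)" by simp
      then show ?thesis using t by (simp add: scaleR_add_right)
    qed
    moreover have "(1 / (1 + t)) *\<^sub>R ?y + (t / (1 + t)) *\<^sub>R ?a \<in> K"
      using t aK calculation(1)
      by (intro convexD[OF convex_convex_hull]) (auto simp flip: add_divide_distrib)
    ultimately show False using x by simp
  qed
  ultimately have R: "?R \<subseteq> connected_component_set ?S x" by (intro connected_component_maximal)
  have "0 < norm (x - ?a)" using x aK by auto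
  \<comment> \<open>Chosen so that the step along the ray has length
    \<open>\<bar>B\<bar> + norm x + 1\<close>, which carries it out of the ball of radius
    \<open>B\<close>.\<close>
  define t where "t = (\<bar>B\<bar> + norm x + 1) / norm (x - ?a)"
  have "0 \<le> t" by (simp add: t_def)
  then have "norm (x + t *\<^sub>R (x - ?a)) \<le> B" using R B by auto
  moreover have "norm (t *\<^sub>R (x - ?a)) \<le> norm (x + t *\<^sub>R (x - ?a)) + norm x"
    using norm_triangle_ineq4[of "x + t *\<^sub>R (x - ?a)" x] by simp
  moreover have "norm (t *\<^sub>R (x - ?a)) = \<bar>B\<bar> + norm x + 1"
    using \<open>0 < norm (x - ?a)\<close> \<open>0 \<le> t\<close> by (simp add: t_def)
  ultimately show False by linarith
qed

lemma region_eq: "region P = K"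
proof -
  have "\<Union>(sides P) \<subseteq> K" using side_subset by (auto simp: sides_def)
  then show ?thesis
    using bounded_component unbounded_component convex_hull_subset_affine_hull[of "set P"]
    unfolding region_def by blast
qed

lemma strictly_convex: "strictly_convex_polygon P"
  using polygon not_collinear by (simp add: strictly_convex_polygon_def region_eq convex_convex_hull)

text \<open>A side is a proper face of the hull, since the corner after its second end is off its
  supporting plane.\<close>

lemma side_disjoint_rel_interior:
  assumes "s \<in> sides P"
  shows "s \<inter> rel_interior (region P) = {}"
proof -
  obtain i where i: "i < length P" "s = side P i" using assms by (auto simp: sides_def)
  have "K \<subseteq> {x. c i \<le> n i \<bullet> x}"
    using in_set_support i by (intro hull_minimal) (auto simp: convex_halfspace_ge)
  then have "(K \<inter> {x. n i \<bullet> x = c i}) face_of K"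
    by (intro face_of_Int_supporting_hyperplane_ge) auto
  moreover have "K \<inter> {x. n i \<bullet> x = c i} \<noteq> K"
  proof -
    let ?k = "Suc (Suc i) mod length P"
    have "P ! ?k \<in> K" using next_less by (intro hull_inc) simp
    moreover have "n i \<bullet> P ! ?k \<noteq> c i" using support_eq[OF i(1) next_less] next_neq[OF i(1)] by auto
    ultimately show ?thesis by blast
  qed
  ultimately show ?thesis unfolding region_eq i side_eq_face[OF i(1)] by (rule face_of_disjoint_rel_interior)
qed

text \<open>This will separate the polygons of different vertices: two equal ones would meet in
  their whole region, although contacts are sides.\<close>

lemma region_notin_sides: "region P \<notin> sides P"
proof
  assume "region P \<in> sides P"
  then have "rel_interior (region P) = {}"
    using side_disjoint_rel_interior rel_interior_subset by fastforce
  then have "set P = {}" by (simp add: region_eq convex_convex_hull rel_interior_eq_empty)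
  then show False using len by simp
qed

end


section \<open>Polygons on a parabolic cylinder\<close>

definition para :: "nat \<Rightarrow> real \<Rightarrow> real^3" where
  "para t h = vector [real t, (real t)\<^sup>2, h]"

definition para_polygon :: "nat set \<Rightarrow> real \<Rightarrow> (real^3) list" where
  "para_polygon T h = map (\<lambda>t. para t h) (sorted_list_of_set T)"

definition wall_rectangle :: "nat \<Rightarrow> real \<Rightarrow> real \<Rightarrow> (real^3) list" where
  "wall_rectangle a l h = [para a l, para (Suc a) l, para (Suc a) h, para a h]"

definition rung :: "nat \<Rightarrow> real \<Rightarrow> (real^3) set" where
  "rung a h = closed_segment (para a h) (para (Suc a) h)"

text \<open>The case \<open>l = h\<close> is allowed and gives a rung, so that the traces of
  horizontal polygons and of rectangles on a wall have a common form.\<close>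

definition slab :: "nat \<Rightarrow> real \<Rightarrow> real \<Rightarrow> (real^3) set" where
  "slab a l h = convex hull set (wall_rectangle a l h)"

text \<open>For points of the parabola, the inequality of the wall reads \<open>(t - a) (t - (a + 1)) \<ge> 0\<close>.\<close>

definition wall :: "nat \<Rightarrow> (real^3) set" where
  "wall a = {x. vector [- real (2 * a + 1), 1, 0] \<bullet> x = - real (a * Suc a)}"

lemma inner_vector_3: "(vector [a, b, c] :: real^3) \<bullet> x = a * x $ 1 + b * x $ 2 + c * x $ 3"
  by (simp add: inner_vec_def sum_3)

lemma para_nth [simp]: "para t h $ 1 = real t" "para t h $ 2 = (real t)\<^sup>2" "para t h $ 3 = h"
  by (simp_all add: para_def)

text \<open>Coordinate directions suffice as normals: the first coordinate tells the two vertical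
  sides apart, the third one the horizontal sides.\<close>

lemma supported_chain_wall_rectangle:
  assumes "l < h"
  shows "\<exists>n c. supported_chain (wall_rectangle a l h) n c"
proof (intro exI)
  let ?P = "wall_rectangle a l h"
  define n :: "nat \<Rightarrow> real^3" where
    "n i = [vector [0, 0, 1], vector [- 1, 0, 0], vector [0, 0, - 1], vector [1, 0, 0]] ! i" for i
  define c where "c i = [l, - real (Suc a), - h, real a] ! i" for i
  have four: "i = 0 \<or> i = 1 \<or> i = 2 \<or> i = 3" if "i < length ?P" for i
    using that by (auto simp: wall_rectangle_def)
  show "supported_chain ?P n c"
  proof
    show "3 \<le> length ?P" by (simp add: wall_rectangle_def)
    have "para a h = 1 *\<^sub>R para a l + (- 1) *\<^sub>R para (Suc a) l + 1 *\<^sub>R para (Suc a) h"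
      by (simp add: vec_eq_iff forall_3)
    moreover have "1 + (- 1) + 1 = (1 :: real)" by simp
    ultimately have "para a h \<in> affine hull {para a l, para (Suc a) l, para (Suc a) h}"
      unfolding affine_hull_3 by blast
    then have "set ?P \<subseteq> affine hull {para a l, para (Suc a) l, para (Suc a) h}"
      by (simp add: wall_rectangle_def hull_inc)
    then show "coplanar (set ?P)" unfolding coplanar_def by blast
    fix i k assume i: "i < length ?P" and k: "k < length ?P"
    show "c i \<le> n i \<bullet> ?P ! k" using four[OF i] four[OF k] assms
      by (elim disjE; simp add: wall_rectangle_def n_def c_def inner_vector_3)
    show "n i \<bullet> ?P ! k = c i \<longleftrightarrow> k = i \<or> k = Suc i mod length ?P"
      using four[OF i] four[OF k] assms
      by (elim disjE; simp add: wall_rectangle_def n_def c_def inner_vector_3)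
  qed
qed

text \<open>For consecutive parameters \<open>p\<close>, \<open>q\<close> of \<open>T\<close>, every
  \<open>t\<close> in \<open>T\<close> satisfies (t - p)(t - q) \<ge> 0, because none lies strictly
  between. The closing side joins the largest to the smallest parameter, so the sign is reversed.
  Both products are affine in \<open>t\<close> and its square, hence come from planes.\<close>

lemma supported_chain_para_polygon:
  assumes T: "finite T" "3 \<le> card T"
  shows "\<exists>n c. supported_chain (para_polygon T h) n c"
proof (intro exI)
  let ?P = "para_polygon T h" and ?xs = "sorted_list_of_set T"
  define x where "x i = real (?xs ! i)" for i
  define n :: "nat \<Rightarrow> real^3" where
    "n i = (if Suc i < card T then vector [- (x i + x (Suc i)), 1, 0] else vector [x i + x 0, - 1, 0])" for i
  define c where "c i = (if Suc i < card T then - (x i * x (Suc i)) else x i * x 0)" for i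
  have len: "length ?P = card T" "length ?xs = card T" using T by (simp_all add: para_polygon_def)
  have mono: "x i < x j" if "i < j" "j < card T" for i j
    using sorted_wrt_nth_less[OF strict_sorted_list_of_set[of T]] that len by (simp add: x_def)
  have mono': "x i \<le> x j" if "i \<le> j" "j < card T" for i j
    using mono[of i j] that by (cases "i = j") auto
  have eq: "x i = x j \<longleftrightarrow> i = j" if "i < card T" "j < card T" for i j
    using mono[of i j] mono[of j i] that by (cases i j rule: linorder_cases) auto
  have P: "?P ! k $ 1 = x k" "?P ! k $ 2 = (x k)\<^sup>2" "?P ! k $ 3 = h" if "k < card T" for k
    using that len by (simp_all add: para_polygon_def x_def)
  have val: "n i \<bullet> ?P ! k - c i = (if Suc i < card T then (x k - x i) * (x k - x (Suc i))
      else (x i - x k) * (x k - x 0))" if "k < card T" for i k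
    by (simp add: n_def c_def inner_vector_3 P[OF that] power2_eq_square algebra_simps)
  show "supported_chain ?P n c"
  proof
    show "3 \<le> length ?P" using T len by simp
    let ?O = "vector [0, 0, h] :: real^3" and ?X = "vector [1, 0, h] :: real^3"
      and ?Y = "vector [0, 1, h] :: real^3"
    have "para t h \<in> affine hull {?O, ?X, ?Y}" for t
    proof -
      have "para t h = (1 - real t - (real t)\<^sup>2) *\<^sub>R ?O + real t *\<^sub>R ?X + (real t)\<^sup>2 *\<^sub>R ?Y"
        by (simp add: vec_eq_iff forall_3 algebra_simps)
      moreover have "(1 - real t - (real t)\<^sup>2) + real t + (real t)\<^sup>2 = 1" by simp
      ultimately show ?thesis unfolding affine_hull_3 by blast
    qed
    then have "set ?P \<subseteq> affine hull {?O, ?X, ?Y}" by (auto simp: para_polygon_def)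
    then show "coplanar (set ?P)" unfolding coplanar_def by blast
    fix i k assume i: "i < length ?P" and k: "k < length ?P"
    have ik: "i < card T" "k < card T" using i k len by simp_all
    show "c i \<le> n i \<bullet> ?P ! k"
    proof (cases "Suc i < card T")
      case True
      have "0 \<le> (x k - x i) * (x k - x (Suc i))"
      proof (cases "k \<le> i")
        case True
        then show ?thesis using mono'[of k i] mono'[of k "Suc i"] ik \<open>Suc i < card T\<close>
          by (intro mult_nonpos_nonpos) auto
      next
        case False
        then show ?thesis using mono'[of i k] mono'[of "Suc i" k] ik
          by (intro mult_nonneg_nonneg) auto
      qed
      then show ?thesis using val[OF ik(2), of i] True by simp
    next
      case False
      then have "0 \<le> (x i - x k) * (x k - x 0)"
        using mono'[of k i] mono'[of 0 k] ik by (intro mult_nonneg_nonneg) auto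
      then show ?thesis using val[OF ik(2), of i] False by simp
    qed
    have "n i \<bullet> ?P ! k = c i \<longleftrightarrow> n i \<bullet> ?P ! k - c i = 0" by simp
    also have "\<dots> \<longleftrightarrow> (if Suc i < card T then k = i \<or> k = Suc i else k = i \<or> k = 0)"
      using eq[of k i] eq[of i k] eq[of k "Suc i"] eq[of k 0] ik unfolding val[OF ik(2)] by auto
    also have "\<dots> \<longleftrightarrow> k = i \<or> k = Suc i mod length ?P"
      using ik unfolding len by (auto simp: mod_Suc)
    finally show "n i \<bullet> ?P ! k = c i \<longleftrightarrow> k = i \<or> k = Suc i mod length ?P" .
  qed
qed

text \<open>Consecutive natural numbers in \<open>T\<close> are neighbours in the sorted list, as an
  entry between them would be a natural number strictly between.\<close>

lemma rung_in_sides_para_polygon: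
  assumes T: "finite T" "a \<in> T" "Suc a \<in> T"
  shows "rung a h \<in> sides (para_polygon T h)"
proof -
  let ?xs = "sorted_list_of_set T"
  have less: "?xs ! i < ?xs ! j" if "i < j" "j < length ?xs" for i j
    using sorted_wrt_nth_less[OF strict_sorted_list_of_set[of T]] that by simp
  obtain k where k: "k < length ?xs" "?xs ! k = a"
    using T by (metis in_set_conv_nth set_sorted_list_of_set)
  obtain m where m: "m < length ?xs" "?xs ! m = Suc a"
    using T by (metis in_set_conv_nth set_sorted_list_of_set)
  have "\<not> m \<le> k" using less[of m k] k m by (cases "m = k") auto
  moreover have "\<not> Suc k < m" using less[of k "Suc k"] less[of "Suc k" m] k m by auto
  ultimately have "m = Suc k" by simp
  then have "side (para_polygon T h) k = rung a h"
    using k m by (simp add: side_def next_corner_def para_polygon_def rung_def)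
  moreover have "k < length (para_polygon T h)" using k by (simp add: para_polygon_def)
  ultimately show ?thesis by (auto simp: sides_def)
qed

lemma rung_in_sides_wall_rectangle:
  "rung a l \<in> sides (wall_rectangle a l h)" "rung a h \<in> sides (wall_rectangle a l h)"
proof -
  have "side (wall_rectangle a l h) 0 = rung a l" "side (wall_rectangle a l h) 2 = rung a h"
    by (simp_all add: side_def next_corner_def wall_rectangle_def rung_def closed_segment_commute)
  moreover have "0 < length (wall_rectangle a l h)" "2 < length (wall_rectangle a l h)"
    by (simp_all add: wall_rectangle_def)
  ultimately show "rung a l \<in> sides (wall_rectangle a l h)" "rung a h \<in> sides (wall_rectangle a l h)"
    unfolding sides_def by (metis imageI lessThan_iff)+
qed

lemma para_on_wall: "para t h \<in> wall a \<longleftrightarrow> t = a \<or> t = Suc a"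
  and para_wall_ge: "- real (a * Suc a) \<le> vector [- real (2 * a + 1), 1, 0] \<bullet> para t h"
proof -
  have e: "vector [- real (2 * a + 1), 1, 0] \<bullet> para t h - - real (a * Suc a) =
      (real t - real a) * (real t - real (Suc a))"
    by (simp add: inner_vector_3 power2_eq_square algebra_simps)
  have "para t h \<in> wall a \<longleftrightarrow> (real t - real a) * (real t - real (Suc a)) = 0"
    unfolding e[symmetric] wall_def by simp
  then show "para t h \<in> wall a \<longleftrightarrow> t = a \<or> t = Suc a"
    by (simp only: mult_eq_0_iff right_minus_eq of_nat_eq_iff)
  \<comment> \<open>This uses that \<open>t\<close> is natural: either \<open>t \<le> a\<close> or
    \<open>t \<ge> a + 1\<close>, so the factors have no opposite signs.\<close>
  have "0 \<le> (real t - real a) * (real t - real (Suc a))"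
    by (cases "t \<le> a") (auto intro: mult_nonpos_nonpos mult_nonneg_nonneg)
  then show "- real (a * Suc a) \<le> vector [- real (2 * a + 1), 1, 0] \<bullet> para t h"
    unfolding e[symmetric] by simp
qed

text \<open>Each wall supports all points above natural parameters, whatever their heights, so
  horizontal polygons and rectangles need no separate treatment.\<close>

lemma convex_hull_Int_wall:
  assumes "finite A" "A \<subseteq> range (case_prod para)"
  shows "convex hull A \<inter> wall a = convex hull (A \<inter> wall a)"
  unfolding wall_def
  by (rule convex_hull_Int_supporting_hyperplane) (use assms para_wall_ge in \<open>auto simp del: of_nat_add of_nat_mult\<close>)

lemma slab_height: "x \<in> slab a l h \<Longrightarrow> l \<le> h \<Longrightarrow> l \<le> x $ 3 \<and> x $ 3 \<le> h"
proof -
  assume "x \<in> slab a l h" "l \<le> h"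
  have "convex {x :: real^3. l \<le> x $ 3 \<and> x $ 3 \<le> h}"
  proof -
    have "{x :: real^3. l \<le> x $ 3 \<and> x $ 3 \<le> h} = {x. axis 3 1 \<bullet> x \<ge> l} \<inter> {x. axis 3 1 \<bullet> x \<le> h}"
      by (auto simp: inner_axis')
    then show ?thesis by (simp add: convex_Int convex_halfspace_le convex_halfspace_ge)
  qed
  then have "slab a l h \<subseteq> {x. l \<le> x $ 3 \<and> x $ 3 \<le> h}"
    unfolding slab_def using \<open>l \<le> h\<close> by (intro hull_minimal) (auto simp: wall_rectangle_def)
  then show ?thesis using \<open>x \<in> slab a l h\<close> by blast
qed

lemma slab_Int_height:
  assumes "l \<le> h"
  shows "slab a l h \<inter> {x. x $ 3 = l} = rung a l" "slab a l h \<inter> {x. x $ 3 = h} = rung a h"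
proof -
  let ?R = "set (wall_rectangle a l h)"
  have e: "{x :: real^3. x $ 3 = l} = {x. axis 3 1 \<bullet> x = l}"
    "{x :: real^3. x $ 3 = h} = {x. axis 3 (- 1) \<bullet> x = - h}" by (auto simp: inner_axis')
  have "slab a l h \<inter> {x. x $ 3 = l} = convex hull (?R \<inter> {x. x $ 3 = l})"
    unfolding slab_def e using assms
    by (intro convex_hull_Int_supporting_hyperplane) (auto simp: wall_rectangle_def inner_axis')
  also have "?R \<inter> {x. x $ 3 = l} = {para a l, para (Suc a) l}" by (auto simp: wall_rectangle_def)
  finally show "slab a l h \<inter> {x. x $ 3 = l} = rung a l" by (simp add: rung_def segment_convex_hull)
  have "slab a l h \<inter> {x. x $ 3 = h} = convex hull (?R \<inter> {x. x $ 3 = h})"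
    unfolding slab_def e using assms
    by (intro convex_hull_Int_supporting_hyperplane) (auto simp: wall_rectangle_def inner_axis')
  also have "?R \<inter> {x. x $ 3 = h} = {para a h, para (Suc a) h}" by (auto simp: wall_rectangle_def)
  finally show "slab a l h \<inter> {x. x $ 3 = h} = rung a h" by (simp add: rung_def segment_convex_hull)
qed

lemma slab_Int_slab:
  assumes "l \<le> h" "h \<le> l'" "l' \<le> h'"
  shows "slab a l h \<inter> slab a l' h' = (if h = l' then rung a h else {})"
proof (cases "h = l'")
  case True
  have "slab a l h \<inter> slab a l' h' = (slab a l h \<inter> {x. x $ 3 = h}) \<inter> (slab a l' h' \<inter> {x. x $ 3 = l'})"
    using slab_height[of _ a l h] slab_height[of _ a l' h'] assms True by force
  then show ?thesis using slab_Int_height assms True by auto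
next
  case False
  then show ?thesis using slab_height[of _ a l h] slab_height[of _ a l' h'] assms by force
qed

section \<open>The polygons of a layout and their contacts\<close>

locale drawing = layout G z H lo hi cl for G :: "'a pair_pre_digraph" and z H lo hi cl +
  fixes num :: "'a set \<Rightarrow> nat"
  assumes H: "pair_graph H" and inj_z: "inj_on z (pverts G)"
    and finite_edges: "finite (edge_set G)" and inj_num: "inj_on num (edge_set G)"
    and all_subdivided: "parcs G \<inter> parcs H = {}"
begin

text \<open>The factor 2 makes the pairs of parameters of different edges disjoint, and the offset 3
  keeps them clear of the auxiliary parameters 0, 1, 2.\<close>

definition base :: "'a set \<Rightarrow> nat" where
  "base e = 2 * num e + 3"

text \<open>The parameters 0, 1, 2 only ensure that there are at least three corners.\<close>

definition corner_params :: "'a \<Rightarrow> nat set" where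
  "corner_params x = {0, 1, 2} \<union> (\<Union>e\<in>{e \<in> edge_set G. x \<in> e}. {base e, Suc (base e)})"

definition cell :: "'a \<Rightarrow> (real^3) list" where
  "cell x = (if x \<in> pverts G then para_polygon (corner_params x) (lo x)
     else wall_rectangle (base (cl x)) (lo x) (hi x))"

lemma base_eq:
  assumes "e \<in> edge_set G" "e' \<in> edge_set G" "t \<in> {base e, Suc (base e)}" "t \<in> {base e', Suc (base e')}"
  shows "e = e'"
proof -
  have "num e = num e'" using assms(3,4) unfolding base_def by (auto; presburger)
  then show ?thesis using assms(1,2) inj_num by (auto dest: inj_onD)
qed

lemma corner_params: "finite (corner_params x)" "3 \<le> card (corner_params x)"
proof -
  show f: "finite (corner_params x)" using finite_edges by (simp add: corner_params_def)
  have "{0, 1, 2} \<subseteq> corner_params x" by (auto simp: corner_params_def)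
  then show "3 \<le> card (corner_params x)" using card_mono[OF f, of "{0, 1, 2}"] by simp
qed

lemma corner_params_Int:
  assumes "e \<in> edge_set G"
  shows "corner_params x \<inter> {base e, Suc (base e)} = (if x \<in> e then {base e, Suc (base e)} else {})"
proof -
  have "x \<in> e" if t: "t \<in> corner_params x" "t \<in> {base e, Suc (base e)}" for t
  proof -
    have "t \<notin> {0, 1, 2}" using t(2) by (auto simp: base_def)
    then obtain e' where "e' \<in> edge_set G" "x \<in> e'" "t \<in> {base e', Suc (base e')}"
      using t(1) unfolding corner_params_def by blast
    then show ?thesis using base_eq[OF assms] t(2) by blast
  qed
  moreover have "{base e, Suc (base e)} \<subseteq> corner_params x" if "x \<in> e"
    using assms that by (auto simp: corner_params_def)
  ultimately show ?thesis by auto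
qed

lemma lo_le_hi: "x \<in> pverts H \<Longrightarrow> lo x \<le> hi x"
  using original[of x] subdividing[of x] by (cases "x \<in> pverts G") auto

lemma in_column_cl: "x \<in> pverts H \<Longrightarrow> x \<notin> pverts G \<Longrightarrow> in_column G cl x (cl x)"
  using subdividing by (simp add: in_column_def)

lemma supported_chain_cell: "x \<in> pverts H \<Longrightarrow> \<exists>n c. supported_chain (cell x) n c"
  using supported_chain_para_polygon[OF corner_params] supported_chain_wall_rectangle subdividing
  by (simp add: cell_def)

lemma region_cell: "x \<in> pverts H \<Longrightarrow> region (cell x) = convex hull set (cell x)"
  using supported_chain_cell supported_chain.region_eq by blast

lemma region_cell_subdividing:
  assumes "x \<in> pverts H" "x \<notin> pverts G"
  shows "region (cell x) = slab (base (cl x)) (lo x) (hi x)"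
  unfolding region_cell[OF assms(1)] using assms(2) by (simp add: cell_def slab_def)

lemma set_cell: "set (cell x) = (if x \<in> pverts G then (\<lambda>t. para t (lo x)) ` corner_params x
     else set (wall_rectangle (base (cl x)) (lo x) (hi x)))"
  using corner_params by (simp add: cell_def para_polygon_def)

text \<open>The bridge from geometry to \<open>layout\<close>: only corners on the wall count, and
  the parameters of an edge occur exactly in the cells of its column. For a vertex of
  \<open>G\<close> the slab degenerates to a rung.\<close>

lemma region_cell_Int_wall:
  assumes x: "x \<in> pverts H" and e: "e \<in> edge_set G"
  shows "region (cell x) \<inter> wall (base e) = (if in_column G cl x e then slab (base e) (lo x) (hi x) else {})"
proof -
  let ?a = "base e"
  have "set (cell x) \<subseteq> range (case_prod para)"
    by (auto simp: set_cell wall_rectangle_def image_iff)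
  then have "region (cell x) \<inter> wall ?a = convex hull (set (cell x) \<inter> wall ?a)"
    unfolding region_cell[OF x] by (intro convex_hull_Int_wall) auto
  also have "set (cell x) \<inter> wall ?a =
      (if in_column G cl x e then set (wall_rectangle ?a (lo x) (hi x)) else {})"
  proof (cases "x \<in> pverts G")
    case True
    have "set (cell x) \<inter> wall ?a = (\<lambda>t. para t (lo x)) ` (corner_params x \<inter> {?a, Suc ?a})"
      using True by (auto simp: set_cell para_on_wall)
    then show ?thesis
      using True original[of x] e corner_params_Int[OF e, of x]
      by (auto simp: in_column_def wall_rectangle_def)
  next
    case False
    then have cl: "cl x \<in> edge_set G" using subdividing x by blast
    show ?thesis
    proof (cases "cl x = e")
      case True
      then show ?thesis using False e
        by (auto simp: set_cell in_column_def wall_rectangle_def para_on_wall)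
    next
      case ne: False
      then show ?thesis using False base_eq[OF e cl]
        by (auto simp: set_cell in_column_def wall_rectangle_def para_on_wall)
    qed
  qed
  finally show ?thesis by (simp add: slab_def)
qed

lemma region_cell_subset_wall:
  assumes x: "x \<in> pverts H" "x \<notin> pverts G"
  shows "region (cell x) \<subseteq> wall (base (cl x))"
  using region_cell_Int_wall[OF x(1), of "cl x"] region_cell_subdividing[OF x] in_column_cl[OF x]
    subdividing[OF x] by auto

lemma region_cell_height:
  assumes x: "x \<in> pverts H" and p: "p \<in> region (cell x)"
  shows "lo x \<le> p $ 3 \<and> p $ 3 \<le> hi x"
proof (cases "x \<in> pverts G")
  case True
  have "convex {p :: real^3. p $ 3 = lo x}"
  proof -
    have "{p :: real^3. p $ 3 = lo x} = {p. axis 3 1 \<bullet> p = lo x}" by (auto simp: inner_axis')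
    then show ?thesis by (simp add: convex_hyperplane)
  qed
  then have "region (cell x) \<subseteq> {p. p $ 3 = lo x}"
    unfolding region_cell[OF x] using True by (intro hull_minimal) (auto simp: set_cell)
  then show ?thesis using p True original[of x] by auto
next
  case False
  then show ?thesis
    using slab_height[of p "base (cl x)" "lo x" "hi x"] lo_le_hi[OF x] p
      region_cell_subdividing[OF x] by simp
qed

lemma rung_in_sides_cell:
  assumes "x \<in> pverts H" "in_column G cl x e"
  shows "rung (base e) (lo x) \<in> sides (cell x)" "rung (base e) (hi x) \<in> sides (cell x)"
proof -
  have e: "e \<in> edge_set G" using assms by (simp add: in_column_def)
  have "rung (base e) (lo x) \<in> sides (cell x) \<and> rung (base e) (hi x) \<in> sides (cell x)"
  proof (cases "x \<in> pverts G")
    case True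
    then have "x \<in> e" using assms by (simp add: in_column_def)
    then have "base e \<in> corner_params x" "Suc (base e) \<in> corner_params x"
      using corner_params_Int[OF e, of x] by auto
    then show ?thesis
      using True original[of x] rung_in_sides_para_polygon[OF corner_params(1)] by (simp add: cell_def)
  next
    case False
    then show ?thesis using assms rung_in_sides_wall_rectangle by (simp add: cell_def in_column_def)
  qed
  then show "rung (base e) (lo x) \<in> sides (cell x)" "rung (base e) (hi x) \<in> sides (cell x)" by auto
qed

text \<open>Polygons of two vertices of \<open>G\<close> have different heights, so one of the two
  cells is a rectangle and lies entirely in a wall. Within that wall both cells are slabs, and
  \<open>ordered\<close> lets them share at most a rung.\<close>

lemma region_cells_meet:
  assumes x: "x \<in> pverts H" and y: "y \<in> pverts H" and "x \<noteq> y"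
    and ne: "region (cell x) \<inter> region (cell y) \<noteq> {}"
  obtains e h where "in_column G cl x e" "in_column G cl y e"
    "hi x = lo y \<and> h = lo y \<or> hi y = lo x \<and> h = lo x"
    "region (cell x) \<inter> region (cell y) = rung (base e) h"
    "rung (base e) h \<in> sides (cell x)" "rung (base e) h \<in> sides (cell y)"
    "x \<notin> pverts G \<or> y \<notin> pverts G" "region (cell x) \<inter> region (cell y) \<subseteq> wall (base e)"
proof -
  have out: "x \<notin> pverts G \<or> y \<notin> pverts G"
  proof (rule ccontr)
    assume "\<not> ?thesis"
    moreover obtain p where "p \<in> region (cell x)" "p \<in> region (cell y)" using ne by blast
    ultimately have "x \<in> pverts G" "y \<in> pverts G" "z x = z y"
      using region_cell_height[OF x, of p] region_cell_height[OF y, of p] original[of x] original[of y]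
      by auto
    then show False using inj_z \<open>x \<noteq> y\<close> by (auto dest: inj_onD)
  qed
  define e where "e = (if x \<in> pverts G then cl y else cl x)"
  have e: "e \<in> edge_set G" using out subdividing x y by (auto simp: e_def)
  have w: "region (cell x) \<inter> region (cell y) \<subseteq> wall (base e)"
    using out region_cell_subset_wall[OF x] region_cell_subset_wall[OF y] by (auto simp: e_def)
  then have "region (cell x) \<inter> region (cell y) =
      (region (cell x) \<inter> wall (base e)) \<inter> (region (cell y) \<inter> wall (base e))" by blast
  then have I: "in_column G cl x e" "in_column G cl y e"
    and S: "region (cell x) \<inter> region (cell y) = slab (base e) (lo x) (hi x) \<inter> slab (base e) (lo y) (hi y)"
    using ne unfolding region_cell_Int_wall[OF x e] region_cell_Int_wall[OF y e]
    by (auto split: if_splits)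
  consider "hi x \<le> lo y" | "hi y \<le> lo x" using ordered[OF x y \<open>x \<noteq> y\<close> I] by blast
  then show ?thesis
  proof cases
    case 1
    then have "hi x = lo y \<and> region (cell x) \<inter> region (cell y) = rung (base e) (lo y)"
      using ne slab_Int_slab[of "lo x" "hi x" "lo y" "hi y" "base e"] lo_le_hi x y
      unfolding S by (auto split: if_splits)
    then show ?thesis
      using that[of e "lo y"] I out w rung_in_sides_cell[OF x I(1)] rung_in_sides_cell[OF y I(2)] by simp
  next
    case 2
    then have "hi y = lo x \<and> region (cell x) \<inter> region (cell y) = rung (base e) (lo x)"
      using ne slab_Int_slab[of "lo y" "hi y" "lo x" "hi x" "base e"] lo_le_hi x y
      unfolding S by (auto split: if_splits)
    then show ?thesis
      using that[of e "lo x"] I out w rung_in_sides_cell[OF x I(1)] rung_in_sides_cell[OF y I(2)] by simp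
  qed
qed

text \<open>A point common to two cells lies on the wall of a shared column, so a third cell through
  it belongs to this column too; its height then contradicts \<open>no_triple\<close>.\<close>

lemma three_regions_disjoint:
  assumes V: "x \<in> pverts H" "y \<in> pverts H" "x' \<in> pverts H" and ne: "x \<noteq> y" "y \<noteq> x'" "x \<noteq> x'"
  shows "region (cell x) \<inter> region (cell y) \<inter> region (cell x') = {}"
proof (rule ccontr)
  assume "\<not> ?thesis"
  then obtain p where p: "p \<in> region (cell x)" "p \<in> region (cell y)" "p \<in> region (cell x')" by blast
  then have "region (cell x) \<inter> region (cell y) \<noteq> {}" by blast
  then obtain e where e: "in_column G cl x e" "in_column G cl y e"
    "region (cell x) \<inter> region (cell y) \<subseteq> wall (base e)"
    using region_cells_meet[OF V(1,2) ne(1)] by metis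
  then have "p \<in> region (cell x') \<inter> wall (base e)" using p by blast
  moreover have "e \<in> edge_set G" using e by (simp add: in_column_def)
  ultimately have "in_column G cl x' e"
    using region_cell_Int_wall[OF V(3), of e] by (auto split: if_splits)
  then show False
    using no_triple[OF V ne e(1,2), of "p $ 3"] region_cell_height V p by auto
qed

lemma inj_cell: "inj_on cell (pverts H)"
proof (rule inj_onI, rule ccontr)
  fix x y assume xy: "x \<in> pverts H" "y \<in> pverts H" and eq: "cell x = cell y" and "x \<noteq> y"
  obtain n c where "supported_chain (cell x) n c" using supported_chain_cell[OF xy(1)] by blast
  then interpret supported_chain "cell x" n c .
  have "set (cell x) \<noteq> {}" using len by auto
  then have "region (cell x) \<inter> region (cell y) \<noteq> {}"
    using eq region_cell[OF xy(1)] by simp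
  then have "region (cell x) \<inter> region (cell y) \<in> sides (cell x)"
    using region_cells_meet[OF xy \<open>x \<noteq> y\<close>] by metis
  then show False using region_notin_sides eq by simp
qed

lemma sides_cell_subset_region:
  assumes "x \<in> pverts H" "s \<in> sides (cell x)"
  shows "s \<subseteq> region (cell x)"
  using assms by (auto simp: region_def)

lemma arc_iff_common_side:
  assumes x: "x \<in> pverts H" and y: "y \<in> pverts H" and "x \<noteq> y"
  shows "(x, y) \<in> parcs H \<longleftrightarrow> sides (cell x) \<inter> sides (cell y) \<noteq> {}"
proof
  assume xy: "(x, y) \<in> parcs H"
  \<comment> \<open>Here the subdivision of every edge enters: an arc between two vertices of
    \<open>G\<close> would be an original edge that is still present, and no contact could realise
    it.\<close>
  then have "(x, y) \<notin> parcs G" using all_subdivided by blast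
  then have "x \<notin> pverts G \<or> y \<notin> pverts G" using original_arcs_iff[of x y] xy by blast
  then obtain e where "in_column G cl x e" "in_column G cl y e" "hi x = lo y \<or> hi y = lo x"
    using arcs_iff[OF x y] xy by blast
  then show "sides (cell x) \<inter> sides (cell y) \<noteq> {}"
    using rung_in_sides_cell[OF x, of e] rung_in_sides_cell[OF y, of e] by auto
next
  assume "sides (cell x) \<inter> sides (cell y) \<noteq> {}"
  then obtain s where s: "s \<in> sides (cell x)" "s \<in> sides (cell y)" by blast
  moreover have "s \<noteq> {}" using s by (auto simp: sides_def side_def)
  ultimately have "region (cell x) \<inter> region (cell y) \<noteq> {}"
    using sides_cell_subset_region x y by blast
  then obtain e h where "in_column G cl x e" "in_column G cl y e" "x \<notin> pverts G \<or> y \<notin> pverts G"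
    "hi x = lo y \<and> h = lo y \<or> hi y = lo x \<and> h = lo x"
    using region_cells_meet[OF x y \<open>x \<noteq> y\<close>] by metis
  then show "(x, y) \<in> parcs H" using arcs_iff[OF x y] \<open>x \<noteq> y\<close> by blast
qed

lemma region_Int_in_sides:
  assumes "x \<in> pverts H" "y \<in> pverts H" "x \<noteq> y" "region (cell x) \<inter> region (cell y) \<noteq> {}"
  shows "region (cell x) \<inter> region (cell y) \<in> sides (cell x) \<inter> sides (cell y)"
  using region_cells_meet[OF assms] by (metis IntI)

text \<open>Every contact is a complete side and triple contacts do not occur. A side misses the
  relative interiors of its polygons, which makes these disjoint.\<close>

lemma convex_polyhedral_surface_cells: "convex_polyhedral_surface (cell ` pverts H)"
proof -
  interpret H: pair_graph H by (fact H)
  have str: "strictly_convex_polygon (cell x)" if "x \<in> pverts H" for x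
    using supported_chain_cell[OF that] supported_chain.strictly_convex by blast
  have rel: "rel_interior (region (cell x)) \<inter> rel_interior (region (cell y)) = {}"
    if "x \<in> pverts H" "y \<in> pverts H" "x \<noteq> y" for x y
  proof (rule ccontr)
    assume "\<not> ?thesis"
    then obtain p where p: "p \<in> rel_interior (region (cell x))" "p \<in> rel_interior (region (cell y))" by blast
    then have pr: "p \<in> region (cell x) \<inter> region (cell y)" using rel_interior_subset by blast
    then have "region (cell x) \<inter> region (cell y) \<in> sides (cell x)"
      using region_Int_in_sides[OF that] by blast
    then have "region (cell x) \<inter> region (cell y) \<inter> rel_interior (region (cell x)) = {}"
      using supported_chain_cell[OF that(1)] supported_chain.side_disjoint_rel_interior by blast
    then show False using p pr by blast
  qed
  show ?thesis unfolding convex_polyhedral_surface_def polyhedral_surface_def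
  proof (intro conjI ballI impI)
    show "finite (cell ` pverts H)" using H.pair_finite_verts by simp
  next
    fix P assume "P \<in> cell ` pverts H"
    then show "strictly_convex_polygon P" using str by blast
    then show "polygon P" by (simp add: strictly_convex_polygon_def)
  next
    fix P Q assume "P \<in> cell ` pverts H" "Q \<in> cell ` pverts H" "P \<noteq> Q"
    then obtain x y where xy: "x \<in> pverts H" "y \<in> pverts H" "x \<noteq> y" "P = cell x" "Q = cell y" by blast
    show "rel_interior (region P) \<inter> rel_interior (region Q) = {}" using rel xy by simp
    assume "region P \<inter> region Q \<noteq> {}"
    then show "(\<exists>c\<in>set P \<inter> set Q. region P \<inter> region Q = {c}) \<or> region P \<inter> region Q \<in> sides P \<inter> sides Q"
      using region_Int_in_sides xy by blast
  next
    fix P Q R assume "P \<in> cell ` pverts H" "Q \<in> cell ` pverts H" "R \<in> cell ` pverts H"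
      "P \<noteq> Q" "Q \<noteq> R" "P \<noteq> R" and ne: "region P \<inter> region Q \<inter> region R \<noteq> {}"
    then have False using three_regions_disjoint by blast
    then show "\<exists>c\<in>set P \<inter> set Q \<inter> set R. region P \<inter> region Q \<inter> region R = {c}" ..
  qed
qed

lemma digraph_iso_adjacency_graph_cells:
  "digraph_iso (with_proj (adjacency_graph (cell ` pverts H))) (with_proj H)"
proof -
  interpret H: pair_graph H by (fact H)
  let ?A = "with_proj (adjacency_graph (cell ` pverts H))"
  define f where "f = the_inv_into (pverts H) cell"
  have f: "f (cell x) = x" if "x \<in> pverts H" for x
    using the_inv_into_f_f[OF inj_cell that] by (simp add: f_def)
  have arcs: "parcs (adjacency_graph (cell ` pverts H)) = map_prod cell cell ` parcs H"
    (is "?L = ?R")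
  proof (intro equalityI subsetI)
    fix a assume "a \<in> ?L"
    then obtain x y where "x \<in> pverts H" "y \<in> pverts H" "a = (cell x, cell y)" "cell x \<noteq> cell y"
      "sides (cell x) \<inter> sides (cell y) \<noteq> {}" by (auto simp: adjacency_graph_def)
    then show "a \<in> ?R" using arc_iff_common_side[of x y] by (auto intro: rev_image_eqI)
  next
    fix a assume "a \<in> ?R"
    then obtain x y where xy: "(x, y) \<in> parcs H" "a = (cell x, cell y)" by auto
    then have "x \<in> pverts H" "y \<in> pverts H" "x \<noteq> y"
      using H.in_arcsD1 H.in_arcsD2 H.no_loops' by blast+
    then show "a \<in> ?L"
      using arc_iff_common_side[of x y] inj_onD[OF inj_cell, of x y] xy by (auto simp: adjacency_graph_def)
  qed
  have verts: "pverts (adjacency_graph (cell ` pverts H)) = cell ` pverts H" by (simp add: adjacency_graph_def)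
  have fa: "map_prod f f (map_prod cell cell a) = a" if "a \<in> parcs H" for a
    using that f H.in_arcsD1 H.in_arcsD2 by (cases a) auto
  let ?h = "\<lparr>iso_verts = f, iso_arcs = map_prod f f, iso_head = snd, iso_tail = fst\<rparr>"
  have "pre_digraph.digraph_isomorphism ?A ?h" unfolding pre_digraph.digraph_isomorphism_def
  proof (intro conjI)
    show "wf_digraph ?A" by unfold_locales (auto simp: adjacency_graph_def)
    show "inj_on (iso_verts ?h) (verts ?A)" using f by (auto simp: verts intro!: inj_onI)
    show "inj_on (iso_arcs ?h) (arcs ?A)"
      unfolding with_proj_simps arcs
    proof (rule inj_on_inverseI[where g = "map_prod cell cell"], elim imageE)
      fix a b assume "b = map_prod cell cell a" "a \<in> parcs H"
      then show "map_prod cell cell (iso_arcs ?h b) = b" using fa[of a] by simp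
    qed
  qed auto
  moreover have "with_proj H = app_iso ?h ?A"
  proof -
    have "f ` cell ` pverts H = pverts H" unfolding image_image using f by simp
    moreover have "map_prod f f ` map_prod cell cell ` parcs H = (\<lambda>a. a) ` parcs H"
      unfolding image_image by (intro image_cong refl fa)
    ultimately show ?thesis by (simp add: app_iso_def with_proj_def verts arcs)
  qed
  ultimately show ?thesis unfolding digraph_iso_def by blast
qed

end

theorem theorem7:
  fixes G G' :: "'a pair_pre_digraph"
  assumes "pair_graph G"
    and "every_edge_subdivided G G'"
  shows "\<exists>S. convex_polyhedral_surface S \<and>
           digraph_iso (with_proj (adjacency_graph S)) (with_proj G')"
proof -
  interpret G: pair_graph G by fact
  have sub: "subdivision_pair G G'" and all: "parcs G \<inter> parcs G' = {}"
    using assms(2) by (auto simp: every_edge_subdivided_def)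
  obtain m :: "'a \<Rightarrow> nat" where m: "inj_on m (pverts G)"
    using finite_imp_inj_to_nat_seg[OF G.pair_finite_verts] by blast
  define z where "z = real \<circ> m"
  have z: "inj_on z (pverts G)" unfolding z_def using m by (intro comp_inj_on) auto
  have fin: "finite (edge_set G)"
  proof -
    have "edge_set G = (\<lambda>(u, v). {u, v}) ` parcs G" by (auto simp: edge_set_def)
    then show ?thesis using G.pair_finite_arcs by simp
  qed
  obtain num :: "'a set \<Rightarrow> nat" where num: "inj_on num (edge_set G)"
    using finite_imp_inj_to_nat_seg[OF fin] by blast
  obtain lo hi cl where "layout G z G' lo hi cl" using layout_exists[OF assms(1) z sub] by blast
  then interpret layout G z G' lo hi cl .
  interpret drawing G z G' lo hi cl num
    by (intro drawing.intro drawing_axioms.intro layout_axioms G.pair_graph_subdivision sub z fin num all)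
  show ?thesis using convex_polyhedral_surface_cells digraph_iso_adjacency_graph_cells by blast
qed

end
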